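(* Let $H$ be an $\ell$-covering $k$-hypergraph for some integers $2\leq\ell<k$. Then $H$ is quasi-eulerian if and only if it has at least two edges.
   Context: A hypergraph $H=(V,E)$ has a non-empty finite vertex set $V$ and a finite collection $E$ of edges, each associated with a subset of $V$; parallel edges (distinct edges with the same vertex set) are allowed, so $E$ is a multiset of subsets of $V$ and edges are counted with multiplicity. An $\ell$-covering $k$-hypergraph is a hypergraph with at least one edge in which every edge has exactly $k$ vertices and every $\ell$-subset of the vertex set is contained in at least one edge. A walk is a sequence $v_0e_1v_1\dots v_{r-1}e_rv_r$ ($r\ge 0$) of vertices $v_i$ and edges $e_i$ such that $v_{i-1}\neq v_i$ and $v_{i-1},v_i\in e_i$ for all $i=1,\dots,r$; its anchors are the vertices $v_0,\dots,v_r$; it is closed if $v_0=v_r$ and trivial if $r=0$. It is a strict trail if $e_1,\dots,e_r$ are pairwise distinct edges. An Euler family of $H$ is a collection of pairwise edge-disjoint and pairwise anchor-disjoint non-trivial closed strict trails of $H$ that jointly traverse every edge of $H$ (exactly once). $H$ is quasi-eulerian if it admits an Euler family. *)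

theory Defs
  imports Main
begin

text \<open>
  Parallel edges are distinct elements of \<open>edges H\<close> with the same value of \<open>inc H\<close>, so the
  multiset of edges is the family \<open>inc H\<close> indexed by \<open>edges H\<close>.
\<close>

record ('v, 'e) pre_hypergraph =
  verts :: "'v set"
  edges :: "'e set"
  inc :: "'e \<Rightarrow> 'v set"

definition hypergraph :: "('v, 'e) pre_hypergraph \<Rightarrow> bool" where
  "hypergraph H \<longleftrightarrow> finite (verts H) \<and> verts H \<noteq> {} \<and> finite (edges H) \<and>
     (\<forall>e\<in>edges H. inc H e \<subseteq> verts H)"

definition covering_hypergraph :: "nat \<Rightarrow> nat \<Rightarrow> ('v, 'e) pre_hypergraph \<Rightarrow> bool" where
  "covering_hypergraph l k H \<longleftrightarrow> hypergraph H \<and> edges H \<noteq> {} \<and>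
     (\<forall>e\<in>edges H. card (inc H e) = k) \<and>
     (\<forall>S. S \<subseteq> verts H \<and> card S = l \<longrightarrow> (\<exists>e\<in>edges H. S \<subseteq> inc H e))"

text \<open>
  The walk \<open>v\<^sub>0 e\<^sub>1 v\<^sub>1 \<dots> e\<^sub>r v\<^sub>r\<close> is the pair \<open>([v\<^sub>0, \<dots>, v\<^sub>r], [e\<^sub>1, \<dots>, e\<^sub>r])\<close>; thus \<open>e\<^sub>i\<close> is at
  list position \<open>i - 1\<close>.
\<close>

type_synonym ('v, 'e) walk = "'v list \<times> 'e list"

definition anchors :: "('v, 'e) walk \<Rightarrow> 'v set" where
  "anchors W = set (fst W)"

definition walk_edges :: "('v, 'e) walk \<Rightarrow> 'e set" where
  "walk_edges W = set (snd W)"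

definition is_walk :: "('v, 'e) pre_hypergraph \<Rightarrow> ('v, 'e) walk \<Rightarrow> bool" where
  "is_walk H W \<longleftrightarrow> (case W of (vs, es) \<Rightarrow>
     length vs = Suc (length es) \<and> set vs \<subseteq> verts H \<and> set es \<subseteq> edges H \<and>
     (\<forall>i<length es. vs ! i \<noteq> vs ! Suc i \<and>
        vs ! i \<in> inc H (es ! i) \<and> vs ! Suc i \<in> inc H (es ! i)))"

definition closed_walk :: "('v, 'e) walk \<Rightarrow> bool" where
  "closed_walk W \<longleftrightarrow> hd (fst W) = last (fst W)"

definition trivial_walk :: "('v, 'e) walk \<Rightarrow> bool" where
  "trivial_walk W \<longleftrightarrow> length (snd W) = 0"

definition strict_trail :: "('v, 'e) pre_hypergraph \<Rightarrow> ('v, 'e) walk \<Rightarrow> bool" where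
  "strict_trail H W \<longleftrightarrow> is_walk H W \<and> distinct (snd W)"

text \<open>
  Taking the family to be a set of walks loses nothing: edge-disjoint non-trivial walks are
  distinct, and a family of them is finite because \<open>edges H\<close> is.
\<close>

definition euler_family :: "('v, 'e) pre_hypergraph \<Rightarrow> ('v, 'e) walk set \<Rightarrow> bool" where
  "euler_family H F \<longleftrightarrow>
     (\<forall>T\<in>F. strict_trail H T \<and> closed_walk T \<and> \<not> trivial_walk T) \<and>
     (\<forall>T\<in>F. \<forall>T'\<in>F. T \<noteq> T' \<longrightarrow> walk_edges T \<inter> walk_edges T' = {}) \<and>
     (\<forall>T\<in>F. \<forall>T'\<in>F. T \<noteq> T' \<longrightarrow> anchors T \<inter> anchors T' = {}) \<and>
     (\<Union>T\<in>F. walk_edges T) = edges H"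

definition quasi_eulerian :: "('v, 'e) pre_hypergraph \<Rightarrow> bool" where
  "quasi_eulerian H \<longleftrightarrow> (\<exists>F. euler_family H F)"

end

theory Submission
  imports Defs
begin

text \<open>
  A single edge carries no closed trail, because its two ends would coincide. All the work lies in
  the converse.

  Suppose that every edge \<open>e\<close> is assigned a pair \<open>p e\<close> of its vertices so that the resulting
  multigraph is even. Then the Euler tours of the nontrivial components of this multigraph are an
  Euler family (\<open>quasi_eulerian_of_even_selection\<close>). So the task is to select
  pairs subject to parity constraints. Since \<open>2 \<le> l < k\<close>, every pair of vertices extends to an
  \<open>l\<close>-set and hence lies in an edge, and edges have at least three vertices.

  For a target set \<open>\<tau>\<close> let \<open>odd_sets I E \<tau>\<close> be the family of sets \<open>\<tau> + \<Sum> p e\<close> modulo 2, and let the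
  deficiency be the least size of a member; an even selection exists iff the deficiency for
  \<open>\<tau> = {}\<close> is 0. These families are even delta-matroids: a member that is not closest to a given set
  gets closer by changing just two elements (\<open>odd_sets_exchange\<close>). The argument is that of the
  Tutte--Berge formula, or of Lovasz's parity factor theorem, in this language.

  Deleting an edge raises the deficiency by at most 2. Deleting it and adding all its vertices to
  the target raises it by at most \<open>k - 2\<close>. Carry out such removals as long as they have the
  maximal effect; let \<open>S\<close> be the set of edges removed in the first way and \<open>T\<close> the set of those
  removed in the second way (\<open>irreducible_reduction\<close>). In what remains, a smallest odd set \<open>B\<close> meets
  no edge twice (\<open>optimal_meets_edge_once\<close>), and as in Gallai's lemma the vertices fall into classes,
  closed under the remaining edges, such that the class of each \<open>u \<in> B\<close> contains only this
  element of \<open>B\<close>. By parity such a class contains a vertex of an edge in \<open>T\<close>. Therefore, if the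
  original deficiency is not 0, hence at least 2,
    \<open>2 + 2 * card S + (k - 2) * card T \<le> card B \<le> k * card T\<close>,
  while every two elements of \<open>B\<close> lie in a common edge of \<open>S \<union> T\<close>. For \<open>card T \<ge> 2\<close> this is impossible
  by double counting (\<open>no_barrier_parameters\<close>). If \<open>T\<close> consists of one edge \<open>e\<close>, then \<open>S = {}\<close> and
  \<open>B \<subseteq> I e\<close>; a second edge either contains two elements of \<open>B\<close> or has a vertex outside \<open>e\<close>, which would
  lie in the class of every element of \<open>B\<close> (\<open>even_selection\<close>).
\<close>

section \<open>Symmetric differences\<close>

definition sym_sum :: "'a set \<Rightarrow> 'a set \<Rightarrow> 'a set"  (infixl "\<triangle>" 65) where
  "A \<triangle> B = {x. (x \<in> A) \<noteq> (x \<in> B)}"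

lemma sym_sum_iff [simp]: "x \<in> A \<triangle> B \<longleftrightarrow> (x \<in> A) \<noteq> (x \<in> B)"
  by (simp add: sym_sum_def)

lemma sym_sum_empty [simp]: "A \<triangle> {} = A" "{} \<triangle> A = A" "A \<triangle> A = {}"
  by auto

lemma sym_sum_cancel [simp]: "A \<triangle> B \<triangle> B = A"
  by auto

lemma sym_sum_assoc: "A \<triangle> (B \<triangle> C) = A \<triangle> B \<triangle> C"
  by auto

lemma sym_sum_right_commute: "A \<triangle> B \<triangle> C = A \<triangle> C \<triangle> B"
  by auto

lemma finite_sym_sum [simp]: "finite A \<Longrightarrow> finite B \<Longrightarrow> finite (A \<triangle> B)"
  by (rule finite_subset[of _ "A \<union> B"]) auto

lemma card_sym_sum:
  assumes "finite A" "finite B"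
  shows "card (A \<triangle> B) + 2 * card (A \<inter> B) = card A + card B"
proof -
  have 1: "card (A \<triangle> B) = card (A - B) + card (B - A)"
    by (subst card_Un_disjoint[symmetric]) (auto simp: assms intro!: arg_cong[of _ _ card])
  have 2: "card A = card (A - B) + card (A \<inter> B)"
    by (subst card_Un_disjoint[symmetric]) (auto simp: assms intro!: arg_cong[of _ _ card])
  have 3: "card B = card (B - A) + card (A \<inter> B)"
    by (subst card_Un_disjoint[symmetric]) (auto simp: assms intro!: arg_cong[of _ _ card])
  show ?thesis using 1 2 3 by simp
qed

lemma odd_card_sym_sum:
  assumes "finite A" "finite B"
  shows "odd (card (A \<triangle> B)) \<longleftrightarrow> odd (card A) \<noteq> odd (card B)"
proof -
  have "odd (card (A \<triangle> B) + 2 * card (A \<inter> B)) \<longleftrightarrow> odd (card A + card B)"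
    by (simp only: card_sym_sum[OF assms])
  then show ?thesis by auto
qed

lemma card_sym_sum_pair:
  assumes "finite A" "x \<noteq> y"
  shows "int (card (A \<triangle> {x, y})) =
    int (card A) + (if x \<in> A then -1 else 1) + (if y \<in> A then -1 else 1)"
proof -
  have "card (A \<inter> {x, y}) = (if x \<in> A then 1 else 0) + (if y \<in> A then 1 else 0)"
    using assms(2) by (auto simp: Int_insert_right)
  moreover have "card (A \<triangle> {x, y}) + 2 * card (A \<inter> {x, y}) = card A + 2"
    using card_sym_sum[of A "{x, y}"] assms by simp
  ultimately show ?thesis by (auto split: if_splits)
qed

lemma card_2_other: "card X = 2 \<Longrightarrow> u \<in> X \<Longrightarrow> \<exists>x. X = {u, x} \<and> u \<noteq> x"
  by (auto simp: card_2_iff)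

section \<open>Vertex sets spanned by pairs\<close>

text \<open>
  The span, over the field with two elements, of the edges of a graph \<open>G\<close>: the finite sets that are
  even on every component of \<open>G\<close>.
\<close>
inductive_set pair_span :: "('v \<times> 'v) set \<Rightarrow> 'v set set" for G where
  empty: "{} \<in> pair_span G"
| step: "J \<in> pair_span G \<Longrightarrow> (x, y) \<in> G \<Longrightarrow> x \<noteq> y \<Longrightarrow> J \<triangle> {x, y} \<in> pair_span G"

lemma finite_pair_span: "J \<in> pair_span G \<Longrightarrow> finite J"
  by (induction rule: pair_span.induct) auto

lemma pair_span_no_generators: "pair_span {} = {{}}"
proof -
  have "J = {}" if "J \<in> pair_span {}" for J :: "'a set"
    using that by (induction rule: pair_span.induct) auto
  then show ?thesis using pair_span.empty by blast
qed

lemma pair_in_pair_span: "(x, y) \<in> G \<Longrightarrow> x \<noteq> y \<Longrightarrow> {x, y} \<in> pair_span G"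
  using pair_span.step[OF pair_span.empty, of x y G] by simp

lemma sym_sum_in_pair_span:
  "K \<in> pair_span G \<Longrightarrow> J \<in> pair_span G \<Longrightarrow> J \<triangle> K \<in> pair_span G"
  by (induction rule: pair_span.induct) (auto simp: sym_sum_assoc intro: pair_span.step)

lemma pair_span_mono: "J \<in> pair_span G \<Longrightarrow> G \<subseteq> G' \<Longrightarrow> J \<in> pair_span G'"
  by (induction rule: pair_span.induct) (auto intro: pair_span.intros)

lemma pair_span_insert:
  "J \<in> pair_span (insert (a, c) G) \<Longrightarrow> J \<in> pair_span G \<or> J \<triangle> {a, c} \<in> pair_span G"
proof (induction rule: pair_span.induct)
  case empty
  then show ?case by (simp add: pair_span.empty)
next
  case (step J x y)
  show ?case
  proof (cases "(x, y) = (a, c)")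
    case True
    with step.IH show ?thesis by auto
  next
    case False
    then have "(x, y) \<in> G" using step by auto
    with step show ?thesis
      by (metis pair_span.step sym_sum_right_commute)
  qed
qed

text \<open>
  Call two vertices equivalent if they are equal or their pair lies in the span. Every spanned set
  is even on each equivalence class. If every class had at most one element of \<open>Z\<close>, then each class
  meeting \<open>Z\<close> would also meet \<open>J \<triangle> Z\<close>, so \<open>J\<close> could not make \<open>Z\<close> smaller.
\<close>
lemma pair_of_pair_span:
  assumes J: "J \<in> pair_span G" and Z: "finite Z" and less: "card (J \<triangle> Z) < card Z"
  obtains x y where "x \<in> Z" "y \<in> Z" "x \<noteq> y" "{x, y} \<in> pair_span G"
proof (rule ccontr)
  assume "\<not> thesis"
  then have no: "\<And>x y. x \<in> Z \<Longrightarrow> y \<in> Z \<Longrightarrow> {x, y} \<in> pair_span G \<Longrightarrow> x = y"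
    using that by blast
  define cls where "cls v = {w. w = v \<or> {v, w} \<in> pair_span G}" for v
  have cls_pair: "x \<in> cls v \<longleftrightarrow> y \<in> cls v" if "{x, y} \<in> pair_span G" "x \<noteq> y" for x y v
  proof -
    have *: "y \<in> cls v" if "{x, y} \<in> pair_span G" "x \<noteq> y" "x \<in> cls v" for x y
    proof (cases "x = v \<or> y = v")
      case True
      then show ?thesis using that by (auto simp: cls_def)
    next
      case False
      then have "{v, x} \<triangle> {x, y} = {v, y}" using that by auto
      moreover have "{v, x} \<in> pair_span G" using that False by (auto simp: cls_def)
      ultimately show ?thesis
        using sym_sum_in_pair_span[OF that(1), of "{v, x}"] by (auto simp: cls_def)
    qed
    show ?thesis using *[of x y] *[of y x] that by (auto simp: insert_commute)
  qed
  have even_cls: "even (card (K \<inter> cls v))" if "K \<in> pair_span G" for K v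
    using that
  proof (induction rule: pair_span.induct)
    case empty
    then show ?case by simp
  next
    case (step K x y)
    have "{x, y} \<in> pair_span G" using step pair_in_pair_span by metis
    then have xy: "x \<in> cls v \<longleftrightarrow> y \<in> cls v" using cls_pair step.hyps by metis
    have "(K \<triangle> {x, y}) \<inter> cls v = (K \<inter> cls v) \<triangle> ({x, y} \<inter> cls v)" by auto
    moreover have "even (card ({x, y} \<inter> cls v))"
      using xy step.hyps by (cases "x \<in> cls v") auto
    moreover have "finite (K \<inter> cls v)" using finite_pair_span step.hyps by blast
    ultimately show ?case using odd_card_sym_sum[of "K \<inter> cls v" "{x, y} \<inter> cls v"] step.IH
      by simp
  qed
  have "\<exists>w. w \<in> J \<triangle> Z \<and> w \<in> cls z" if z: "z \<in> Z" for z
  proof -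
    have "Z \<inter> cls z = {z}" using z no by (auto simp: cls_def)
    then have "odd (card ((J \<inter> cls z) \<triangle> (Z \<inter> cls z)))"
      using odd_card_sym_sum[of "J \<inter> cls z" "Z \<inter> cls z"] even_cls[OF J] finite_pair_span[OF J] Z
      by simp
    then have "(J \<inter> cls z) \<triangle> (Z \<inter> cls z) \<noteq> {}" by (metis card.empty even_zero)
    then show ?thesis by auto
  qed
  \<comment> \<open>A choice of one element of \<open>J \<triangle> Z\<close> in each class that meets \<open>Z\<close>.\<close>
  then obtain f where f: "f z \<in> J \<triangle> Z" "f z \<in> cls z" if "z \<in> Z" for z by metis
  have "inj_on f Z"
  proof (rule inj_onI)
    fix y z assume yz: "y \<in> Z" "z \<in> Z" "f y = f z"
    show "y = z"
    proof (cases "f y = y")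
      case True
      then have "y \<in> cls z" using f yz by metis
      then show ?thesis using no yz by (auto simp: cls_def)
    next
      case False
      moreover have "f y \<in> cls y" using f yz by blast
      ultimately have "{y, f y} \<in> pair_span G" by (simp add: cls_def)
      then have "y \<in> cls z" using cls_pair[of y "f y" z] False f yz by metis
      then show ?thesis using no yz by (auto simp: cls_def)
    qed
  qed
  moreover have "f ` Z \<subseteq> J \<triangle> Z" using f by blast
  moreover have "finite (J \<triangle> Z)" using finite_pair_span[OF J] Z by simp
  ultimately have "card Z \<le> card (J \<triangle> Z)" using card_inj_on_le by blast
  with less show False by simp
qed

section \<open>Odd sets of selections\<close>

definition selection :: "('e \<Rightarrow> 'v set) \<Rightarrow> 'e set \<Rightarrow> ('e \<Rightarrow> 'v set) \<Rightarrow> bool" where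
  "selection I E p \<longleftrightarrow> (\<forall>e\<in>E. p e \<subseteq> I e \<and> card (p e) = 2)"

definition odd_verts :: "('e \<Rightarrow> 'v set) \<Rightarrow> 'e set \<Rightarrow> 'v set" where
  "odd_verts p E = {v. odd (card {e \<in> E. v \<in> p e})}"

text \<open>
  The target \<open>\<tau>\<close> lists the vertices whose degree ought to be odd, so the members are the sets of
  vertices at which a selection misses its prescribed parity.
\<close>
definition odd_sets :: "('e \<Rightarrow> 'v set) \<Rightarrow> 'e set \<Rightarrow> 'v set \<Rightarrow> 'v set set" where
  "odd_sets I E \<tau> = {\<tau> \<triangle> odd_verts p E | p. selection I E p}"

lemma odd_verts_empty [simp]: "odd_verts p {} = {}"
  by (simp add: odd_verts_def)

lemma odd_verts_insert:
  assumes "finite E" "e \<notin> E"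
  shows "odd_verts p (insert e E) = odd_verts p E \<triangle> p e"
proof (rule set_eqI)
  fix v
  have "{f \<in> insert e E. v \<in> p f} =
      (if v \<in> p e then insert e {f \<in> E. v \<in> p f} else {f \<in> E. v \<in> p f})"
    by auto
  then show "v \<in> odd_verts p (insert e E) \<longleftrightarrow> v \<in> odd_verts p E \<triangle> p e"
    using assms by (auto simp: odd_verts_def)
qed

lemma odd_verts_cong: "(\<And>e. e \<in> E \<Longrightarrow> p e = q e) \<Longrightarrow> odd_verts p E = odd_verts q E"
  unfolding odd_verts_def by (metis (mono_tags, lifting) Collect_cong)

lemma odd_sets_empty [simp]: "odd_sets I {} \<tau> = {\<tau>}"
  by (auto simp: odd_sets_def selection_def)

lemma odd_sets_insert:
  assumes "finite E" "e \<notin> E"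
  shows "A \<in> odd_sets I (insert e E) \<tau> \<longleftrightarrow>
    (\<exists>X. X \<subseteq> I e \<and> card X = 2 \<and> A \<triangle> X \<in> odd_sets I E \<tau>)"
proof
  assume "A \<in> odd_sets I (insert e E) \<tau>"
  then obtain p where p: "selection I (insert e E) p" "A = \<tau> \<triangle> odd_verts p (insert e E)"
    by (auto simp: odd_sets_def)
  then have "A \<triangle> p e = \<tau> \<triangle> odd_verts p E"
    using odd_verts_insert[OF assms, of p] by (simp add: sym_sum_assoc)
  then show "\<exists>X. X \<subseteq> I e \<and> card X = 2 \<and> A \<triangle> X \<in> odd_sets I E \<tau>"
    using p by (intro exI[of _ "p e"]) (auto simp: odd_sets_def selection_def)
next
  assume "\<exists>X. X \<subseteq> I e \<and> card X = 2 \<and> A \<triangle> X \<in> odd_sets I E \<tau>"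
  then obtain X p where X: "X \<subseteq> I e" "card X = 2"
    and p: "selection I E p" "A \<triangle> X = \<tau> \<triangle> odd_verts p E"
    by (auto simp: odd_sets_def)
  let ?p = "p(e := X)"
  have "selection I (insert e E) ?p"
    using X p assms by (auto simp: selection_def)
  moreover have "odd_verts ?p E = odd_verts p E"
    using assms by (intro odd_verts_cong) auto
  then have "A = \<tau> \<triangle> odd_verts ?p (insert e E)"
    using odd_verts_insert[OF assms, of ?p] p(2) by (simp add: sym_sum_assoc) (metis sym_sum_cancel)
  ultimately show "A \<in> odd_sets I (insert e E) \<tau>" by (auto simp: odd_sets_def)
qed

lemma odd_sets_remove:
  assumes "finite E" "e \<in> E"
  shows "A \<in> odd_sets I E \<tau> \<longleftrightarrow>
    (\<exists>X. X \<subseteq> I e \<and> card X = 2 \<and> A \<triangle> X \<in> odd_sets I (E - {e}) \<tau>)"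
  using odd_sets_insert[of "E - {e}" e A I \<tau>] assms by (simp add: insert_absorb)

lemma odd_sets_shift: "A \<in> odd_sets I E (\<tau> \<triangle> Y) \<longleftrightarrow> A \<triangle> Y \<in> odd_sets I E \<tau>"
proof -
  have "A = \<tau> \<triangle> Y \<triangle> B \<longleftrightarrow> A \<triangle> Y = \<tau> \<triangle> B" for B
    by (metis sym_sum_cancel sym_sum_right_commute)
  then show ?thesis by (auto simp: odd_sets_def)
qed

lemma finite_odd_sets:
  assumes "finite E" "finite \<tau>" "A \<in> odd_sets I E \<tau>"
  shows "finite A"
  using assms
proof (induction E arbitrary: A rule: finite_induct)
  case empty
  then show ?case by simp
next
  case (insert e E)
  then obtain X where X: "card X = 2" "A \<triangle> X \<in> odd_sets I E \<tau>"
    using odd_sets_insert by metis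
  then have "finite X" using card_ge_0_finite[of X] by simp
  moreover have "finite (A \<triangle> X)" using insert X by blast
  ultimately show ?case by (metis finite_sym_sum sym_sum_cancel)
qed

lemma odd_sets_nonempty:
  assumes "finite E" "\<And>e. e \<in> E \<Longrightarrow> card (I e) \<ge> 2"
  shows "odd_sets I E \<tau> \<noteq> {}"
proof -
  have "\<exists>X. X \<subseteq> I e \<and> card X = 2" if "e \<in> E" for e
    using obtain_subset_with_card_n[OF assms(2)[OF that]] by metis
  then obtain p where "\<forall>e\<in>E. p e \<subseteq> I e \<and> card (p e) = 2" by metis
  then show ?thesis by (auto simp: odd_sets_def selection_def)
qed

lemma parity_odd_sets:
  assumes "finite E" "finite \<tau>" "A \<in> odd_sets I E \<tau>"
    and "\<And>e. e \<in> E \<Longrightarrow> I e \<subseteq> C \<or> I e \<inter> C = {}"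
  shows "odd (card (A \<inter> C)) \<longleftrightarrow> odd (card (\<tau> \<inter> C))"
  using assms
proof (induction E arbitrary: A rule: finite_induct)
  case empty
  then show ?case by simp
next
  case (insert e E)
  then obtain X where X: "X \<subseteq> I e" "card X = 2" "A \<triangle> X \<in> odd_sets I E \<tau>"
    using odd_sets_insert by metis
  have fin: "finite X" "finite (A \<triangle> X)"
    using X(2) card_ge_0_finite[of X] finite_odd_sets[OF insert.hyps(1) insert.prems(1) X(3)]
    by simp_all
  then have finA: "finite A" by (metis finite_sym_sum sym_sum_cancel)
  have "odd (card ((A \<triangle> X) \<inter> C)) \<longleftrightarrow> odd (card (\<tau> \<inter> C))"
    using insert X by blast
  moreover have "(A \<triangle> X) \<inter> C = (A \<inter> C) \<triangle> (X \<inter> C)" by auto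
  moreover have "X \<inter> C = X \<or> X \<inter> C = {}" using X insert.prems(3)[of e] by blast
  then have "even (card (X \<inter> C))" using X by auto
  ultimately show ?case using odd_card_sym_sum[of "A \<inter> C" "X \<inter> C"] fin finA by simp
qed

text \<open>
  Superimpose two selections. On each edge their pairs differ by exchanging 0, 1 or 2 vertices;
  match the vertices given up with those gained. Any subset of these links can be applied to the
  first selection and leaves a pair on each edge, and applying all of them gives the second one.
  So the first odd set may be shifted by anything in the span of the links, and this span contains
  the difference of the two odd sets.
\<close>
lemma odd_sets_links:
  assumes "finite E" "A \<in> odd_sets I E \<tau>" "B \<in> odd_sets I E \<tau>"
  shows "\<exists>G. A \<triangle> B \<in> pair_span G \<and> (\<forall>J\<in>pair_span G. A \<triangle> J \<in> odd_sets I E \<tau>)"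
  using assms
proof (induction E arbitrary: A B rule: finite_induct)
  case empty
  then show ?case by (intro exI[of _ "{}"]) (simp add: pair_span_no_generators)
next
  case (insert e E)
  let ?F = "odd_sets I E \<tau>"
  obtain X where X: "X \<subseteq> I e" "card X = 2" "A \<triangle> X \<in> ?F"
    using insert odd_sets_insert by metis
  obtain Y where Y: "Y \<subseteq> I e" "card Y = 2" "B \<triangle> Y \<in> ?F"
    using insert odd_sets_insert by metis
  obtain G where G: "(A \<triangle> X) \<triangle> (B \<triangle> Y) \<in> pair_span G"
      "\<And>J. J \<in> pair_span G \<Longrightarrow> A \<triangle> X \<triangle> J \<in> ?F"
    using insert.IH[OF X(3) Y(3)] by auto
  have lift: "A \<triangle> J \<in> odd_sets I (insert e E) \<tau>"
    if "J \<triangle> L \<in> pair_span G" "X \<triangle> L \<subseteq> I e" "card (X \<triangle> L) = 2" for J L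
  proof -
    have "A \<triangle> J \<triangle> (X \<triangle> L) = A \<triangle> X \<triangle> (J \<triangle> L)" by auto
    then show ?thesis using G(2)[OF that(1)] that insert.hyps odd_sets_insert by metis
  qed
  have AB: "A \<triangle> B = (A \<triangle> X) \<triangle> (B \<triangle> Y) \<triangle> (X \<triangle> Y)" by auto
  obtain a b where ab: "X = {a, b}" "a \<noteq> b" using X card_2_iff by metis
  obtain c d where cd: "Y = {c, d}" "c \<noteq> d" using Y card_2_iff by metis
  consider "X = Y" | a' b' c' where "X = {a', b'}" "Y = {c', b'}" "a' \<noteq> c'" "a' \<noteq> b'" "c' \<noteq> b'"
    | "X \<inter> Y = {}"
  proof -
    assume same: "X = Y \<Longrightarrow> thesis"
      and one: "\<And>a' b' c'. X = {a', b'} \<Longrightarrow> Y = {c', b'} \<Longrightarrow> a' \<noteq> c' \<Longrightarrow> a' \<noteq> b' \<Longrightarrow> c' \<noteq> b' \<Longrightarrow> thesis"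
      and none: "X \<inter> Y = {} \<Longrightarrow> thesis"
    consider "X \<inter> Y = {}" | "a = c" "b = d" | "a = c" "b \<noteq> d" | "a = d" "b = c"
      | "a = d" "b \<noteq> c" | "b = c" "a \<noteq> d" | "b = d" "a \<noteq> c"
      using ab cd by auto
    then show thesis
      using ab cd same none one[of a b c] one[of a b d] one[of b a c] one[of b a d]
      by cases (auto simp: insert_commute)
  qed
  then show ?case
  proof cases
    case 1
    then show ?thesis using AB G lift[of _ "{}"] X by (intro exI[of _ G]) simp
  next
    case 2
    let ?G = "insert (a', c') G"
    have XY: "X \<triangle> Y = {a', c'}" using 2 by auto
    have "A \<triangle> B \<in> pair_span ?G"
      unfolding AB XY using 2 G(1) by (intro pair_span.step) (auto intro: pair_span_mono)
    moreover have "A \<triangle> J \<in> odd_sets I (insert e E) \<tau>" if "J \<in> pair_span ?G" for J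
      using pair_span_insert[OF that]
    proof
      assume "J \<in> pair_span G"
      then show ?thesis using lift[of J "{}"] X by simp
    next
      assume "J \<triangle> {a', c'} \<in> pair_span G"
      moreover have "X \<triangle> {a', c'} = Y" using 2 by auto
      ultimately show ?thesis using lift[of J "{a', c'}"] Y by simp
    qed
    ultimately show ?thesis by blast
  next
    case 3
    let ?G = "insert (b, d) (insert (a, c) G)"
    have dist: "a \<noteq> b" "a \<noteq> c" "a \<noteq> d" "b \<noteq> c" "b \<noteq> d" "c \<noteq> d" using 3 ab cd by auto
    have sub: "{a, b, c, d} \<subseteq> I e" using X Y ab cd by auto
    have XY: "X \<triangle> Y = {a, c} \<triangle> {b, d}" using ab cd dist by auto
    have "A \<triangle> B \<in> pair_span ?G"
      unfolding AB XY sym_sum_assoc[of _ "{a, c}"] using dist G(1)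
      by (intro pair_span.step) (auto intro: pair_span_mono)
    moreover have "A \<triangle> J \<in> odd_sets I (insert e E) \<tau>" if "J \<in> pair_span ?G" for J
    proof -
      have L: "X \<triangle> {} = {a, b}" "X \<triangle> {a, c} = {c, b}" "X \<triangle> {b, d} = {a, d}"
        "X \<triangle> ({b, d} \<triangle> {a, c}) = {c, d}" using ab dist by auto
      have "J \<triangle> {} \<in> pair_span G \<or> J \<triangle> {a, c} \<in> pair_span G \<or> J \<triangle> {b, d} \<in> pair_span G
          \<or> J \<triangle> ({b, d} \<triangle> {a, c}) \<in> pair_span G"
        using pair_span_insert[OF that] pair_span_insert[of J a c G]
          pair_span_insert[of "J \<triangle> {b, d}" a c G] by (auto simp: sym_sum_assoc)
      then show ?thesis using lift[of J] L sub dist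
        by (metis card_2_iff insert_subset subset_insertI empty_subsetI)
    qed
    ultimately show ?thesis by blast
  qed
qed

text \<open>
  Members of the family that are locally closest to \<open>Y\<close>, with respect to changes of two elements,
  are globally closest. Every optimality argument below uses this, with \<open>Y\<close> empty, a full edge, or
  a single vertex.
\<close>
lemma odd_sets_exchange:
  assumes "finite E" "finite \<tau>" "finite Y" "A \<in> odd_sets I E \<tau>" "B \<in> odd_sets I E \<tau>"
    and less: "card (B \<triangle> Y) < card (A \<triangle> Y)"
  obtains x y where "x \<in> A \<triangle> Y" "y \<in> A \<triangle> Y" "x \<noteq> y" "A \<triangle> {x, y} \<in> odd_sets I E \<tau>"
proof -
  obtain G where G: "A \<triangle> B \<in> pair_span G" "\<forall>J\<in>pair_span G. A \<triangle> J \<in> odd_sets I E \<tau>"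
    using odd_sets_links[OF assms(1,4,5)] by blast
  have "(A \<triangle> B) \<triangle> (A \<triangle> Y) = B \<triangle> Y" by auto
  moreover have "finite (A \<triangle> Y)" using finite_odd_sets assms by (metis finite_sym_sum)
  ultimately obtain x y where "x \<in> A \<triangle> Y" "y \<in> A \<triangle> Y" "x \<noteq> y" "{x, y} \<in> pair_span G"
    using pair_of_pair_span[OF G(1), of "A \<triangle> Y"] less by metis
  with G that show ?thesis by blast
qed

section \<open>Irreducible instances\<close>

definition deficiency :: "('e \<Rightarrow> 'v set) \<Rightarrow> 'e set \<Rightarrow> 'v set \<Rightarrow> nat" where
  "deficiency I E \<tau> = (LEAST d. \<exists>A\<in>odd_sets I E \<tau>. card A = d)"

lemma deficiency_le: "A \<in> odd_sets I E \<tau> \<Longrightarrow> deficiency I E \<tau> \<le> card A"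
  unfolding deficiency_def by (rule Least_le) blast

lemma deficiency_attained:
  assumes "finite E" "\<And>e. e \<in> E \<Longrightarrow> card (I e) \<ge> 2"
  obtains A where "A \<in> odd_sets I E \<tau>" "card A = deficiency I E \<tau>"
proof -
  obtain A where "A \<in> odd_sets I E \<tau>" using odd_sets_nonempty[of E I \<tau>] assms by blast
  then have "\<exists>d. \<exists>A\<in>odd_sets I E \<tau>. card A = d" by blast
  then have "\<exists>A\<in>odd_sets I E \<tau>. card A = deficiency I E \<tau>"
    unfolding deficiency_def by (rule LeastI_ex)
  then show ?thesis using that by blast
qed

text \<open>
  Neither kind of removal of an edge reaches its maximal effect, which is 2 for deletion and
  \<open>card (I e) - 2\<close> for deletion with change of target. So for each edge \<open>e\<close> the other edges have both
  a small odd set and one close to \<open>I e\<close>; these are the witnesses to which local improvement is applied.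
\<close>
locale irreducible_instance =
  fixes I :: "'e \<Rightarrow> 'v set" and E :: "'e set" and \<tau> :: "'v set"
  assumes finite_edges: "finite E"
    and finite_target: "finite \<tau>"
    and edge_size: "e \<in> E \<Longrightarrow> 3 \<le> card (I e)"
    and empty_choice: "e \<in> E \<Longrightarrow>
      deficiency I (E - {e}) \<tau> < deficiency I E \<tau> + 2"
    and full_choice: "e \<in> E \<Longrightarrow>
      deficiency I (E - {e}) (\<tau> \<triangle> I e) + 2 < deficiency I E \<tau> + card (I e)"
begin

abbreviation d :: nat where "d \<equiv> deficiency I E \<tau>"

definition optimal :: "'v set \<Rightarrow> bool" where
  "optimal A \<longleftrightarrow> A \<in> odd_sets I E \<tau> \<and> card A = d"

lemma optimal_finite: "optimal A \<Longrightarrow> finite A"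
  using finite_odd_sets finite_edges finite_target by (auto simp: optimal_def)

lemma finite_edge: "e \<in> E \<Longrightarrow> finite (I e)"
  using edge_size card_ge_0_finite[of "I e"] by fastforce

lemma finite_without: "A \<in> odd_sets I (E - {e}) \<tau> \<Longrightarrow> finite A"
  using finite_odd_sets[of "E - {e}"] finite_edges finite_target by blast

lemma add_pair:
  assumes "e \<in> E" "A \<in> odd_sets I (E - {e}) \<tau>" "x \<in> I e" "y \<in> I e" "x \<noteq> y"
  shows "A \<triangle> {x, y} \<in> odd_sets I E \<tau>" "d \<le> card (A \<triangle> {x, y})"
proof -
  show "A \<triangle> {x, y} \<in> odd_sets I E \<tau>"
    using odd_sets_remove[OF finite_edges assms(1)] assms
    by (metis card_2_iff empty_subsetI insert_subset sym_sum_cancel)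
  then show "d \<le> card (A \<triangle> {x, y})" by (rule deficiency_le)
qed

text \<open>
  Inside one edge the defect can be moved between a selected and an unselected vertex.
\<close>
lemma switch_pair:
  assumes "e \<in> E" "A \<triangle> X \<in> odd_sets I (E - {e}) \<tau>" "X \<subseteq> I e" "card X = 2"
    and "u \<in> X" "w \<in> I e" "w \<notin> X"
  shows "A \<triangle> {u, w} \<in> odd_sets I E \<tau>"
proof -
  obtain b where X: "X = {u, b}" "b \<noteq> u"
    using card_2_other[OF assms(4,5)] by metis
  then have "A \<triangle> {u, w} = A \<triangle> X \<triangle> {w, b}" using assms by auto
  then show ?thesis using add_pair(1)[OF assms(1,2), of w b] X assms by auto
qed

lemma empty_choice_witness:
  assumes "e \<in> E"
  obtains A where "A \<in> odd_sets I (E - {e}) \<tau>" "card A < d + 2"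
proof -
  have "card (I f) \<ge> 2" if "f \<in> E - {e}" for f using edge_size that by fastforce
  then show ?thesis
    using deficiency_attained[of "E - {e}" I \<tau>] empty_choice[OF assms] finite_edges that
    by (metis finite_Diff)
qed

lemma full_choice_witness:
  assumes "e \<in> E"
  obtains A where "A \<in> odd_sets I (E - {e}) \<tau>" "card (A \<triangle> I e) + 2 < d + card (I e)"
proof -
  have "card (I f) \<ge> 2" if "f \<in> E - {e}" for f using edge_size that by fastforce
  then obtain A where "A \<in> odd_sets I (E - {e}) (\<tau> \<triangle> I e)"
      "card A = deficiency I (E - {e}) (\<tau> \<triangle> I e)"
    using deficiency_attained[of "E - {e}" I "\<tau> \<triangle> I e"] finite_edges by (metis finite_Diff)
  then show ?thesis
    using that[of "A \<triangle> I e"] full_choice[OF assms] odd_sets_shift[of A I _ \<tau> "I e"] by simp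
qed

lemma reduce_towards_empty:
  assumes "e \<in> E" "A \<in> odd_sets I (E - {e}) \<tau>" "d + 2 \<le> card A"
  obtains x y where "x \<in> A" "y \<in> A" "x \<noteq> y" "A \<triangle> {x, y} \<in> odd_sets I (E - {e}) \<tau>"
proof -
  obtain B where B: "B \<in> odd_sets I (E - {e}) \<tau>" "card B < d + 2"
    using empty_choice_witness assms by blast
  then have "card (B \<triangle> {}) < card (A \<triangle> {})" using assms by simp
  from odd_sets_exchange[OF finite_Diff[OF finite_edges] finite_target finite.emptyI assms(2) B(1) this]
  show ?thesis using that by (metis sym_sum_empty(1))
qed

lemma reduce_towards_full:
  assumes "e \<in> E" "A \<in> odd_sets I (E - {e}) \<tau>" "d + card (I e) \<le> card (A \<triangle> I e) + 2"
  obtains x y where "x \<in> A \<triangle> I e" "y \<in> A \<triangle> I e" "x \<noteq> y"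
    "A \<triangle> {x, y} \<in> odd_sets I (E - {e}) \<tau>"
proof -
  obtain B where B: "B \<in> odd_sets I (E - {e}) \<tau>" "card (B \<triangle> I e) + 2 < d + card (I e)"
    using full_choice_witness assms by blast
  then have "card (B \<triangle> I e) < card (A \<triangle> I e)" using assms by linarith
  from odd_sets_exchange[OF finite_Diff[OF finite_edges] finite_target finite_edge[OF assms(1)]
      assms(2) B(1) this]
  show ?thesis using that by metis
qed

text \<open>
  If \<open>u\<close> and \<open>w\<close> were two elements of a smallest odd set in one edge \<open>e\<close>, exactly one of them being
  selected by \<open>e\<close> would allow a switch that removes both. If \<open>e\<close> selects both, forget its selection:
  the odd set of the other edges has size \<open>d - 2\<close> and misses \<open>e\<close>. It can then come closer to \<open>I e\<close> by
  changing two elements, as giving \<open>e\<close> all its vertices is cheap; but each of the possible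
  changes, followed by a suitable pair in \<open>e\<close>, has size less than \<open>d\<close>. If \<open>e\<close> selects neither, the
  other edges alone have an odd set of size \<open>d + 2\<close> with at least four elements in \<open>e\<close>. As leaving \<open>e\<close>
  empty is cheap, two elements can be dropped, and a pair in \<open>e\<close> removes two more.
\<close>
lemma optimal_meets_edge_once:
  assumes O: "optimal A" and e: "e \<in> E" and u: "u \<in> A" "u \<in> I e" and w: "w \<in> A" "w \<in> I e"
  shows "u = w"
proof (rule ccontr)
  assume uw: "u \<noteq> w"
  note pair = card_sym_sum_pair
  have finA: "finite A" and A: "A \<in> odd_sets I E \<tau>" "card A = d"
    using O optimal_finite by (auto simp: optimal_def)
  obtain X where X: "X \<subseteq> I e" "card X = 2" "A \<triangle> X \<in> odd_sets I (E - {e}) \<tau>"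
    using iffD1[OF odd_sets_remove[OF finite_edges e] A(1)] by metis
  have both: "x \<in> X \<longleftrightarrow> y \<in> X" if "x \<in> A" "y \<in> A" "x \<in> I e" "y \<in> I e" "x \<noteq> y" for x y
  proof -
    have "\<not> (x \<in> X \<and> y \<notin> X)" if "x \<in> A" "y \<in> A" "x \<in> I e" "y \<in> I e" for x y
    proof
      assume xy: "x \<in> X \<and> y \<notin> X"
      then have "A \<triangle> {x, y} \<in> odd_sets I E \<tau>"
        using switch_pair[OF e X(3,1,2)] that by blast
      then have "d \<le> card (A \<triangle> {x, y})" by (rule deficiency_le)
      moreover have "x \<noteq> y" using xy by blast
      ultimately show False using pair[OF finA, of x y] that A by simp
    qed
    then show ?thesis using that by blast
  qed
  show False
  proof (cases "u \<in> X")
    case True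
    then have X_eq: "X = {u, w}"
      using both[of u w] card_2_other[OF X(2), of u] uw u w by auto
    define B where "B = A \<triangle> X"
    have B: "B \<in> odd_sets I (E - {e}) \<tau>" "finite B" using X finA by (auto simp: B_def X_eq)
    have cB: "int (card B) = int d - 2" using pair[OF finA uw] u w A by (simp add: B_def X_eq)
    have uB: "u \<notin> B" "w \<notin> B" using u w by (auto simp: B_def X_eq)
    have disj: "B \<inter> I e = {}"
    proof (rule ccontr)
      assume "B \<inter> I e \<noteq> {}"
      then obtain a where a: "a \<in> B" "a \<in> I e" by blast
      then have "a \<noteq> u" using uB by blast
      then have "int (card (B \<triangle> {a, u})) = int (card B)"
        using a pair[OF B(2), of a u] uB by simp
      moreover have "d \<le> card (B \<triangle> {a, u})"
        using add_pair(2)[OF e B(1)] a u \<open>a \<noteq> u\<close> by blast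
      ultimately show False using cB by simp
    qed
    have "card (B \<triangle> I e) = card B + card (I e)"
      using card_sym_sum[OF B(2) finite_edge[OF e]] disj by simp
    then have "d + card (I e) \<le> card (B \<triangle> I e) + 2" using cB by linarith
    then obtain x y where xy: "x \<in> B \<triangle> I e" "y \<in> B \<triangle> I e" "x \<noteq> y"
        and C: "B \<triangle> {x, y} \<in> odd_sets I (E - {e}) \<tau>"
      using reduce_towards_full[OF e B(1)] by blast
    have finC: "finite (B \<triangle> {x, y})" using B by simp
    have mixed: False if x: "x \<in> I e" and y: "y \<in> B" and xy: "x \<noteq> y"
      and C: "B \<triangle> {x, y} \<in> odd_sets I (E - {e}) \<tau>" for x y
    proof -
      obtain c where c: "c \<in> I e" "c \<noteq> x" using u w uw by blast
      then have "d \<le> card (B \<triangle> {x, y} \<triangle> {x, c})" using add_pair(2)[OF e C] x by blast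
      moreover have "int (card (B \<triangle> {x, y} \<triangle> {x, c})) = int (card B)"
        using pair[of "B \<triangle> {x, y}" x c] pair[OF B(2) xy] B c x y disj by auto
      ultimately show False using cB by simp
    qed
    consider "x \<in> I e" "y \<in> I e" | "x \<in> I e" "y \<in> B" | "x \<in> B" "y \<in> I e" | "x \<in> B" "y \<in> B"
      using xy by auto
    then show False
    proof cases
      case 1
      then have "d \<le> card (B \<triangle> {x, y} \<triangle> {x, y})" using add_pair(2)[OF e C] xy by blast
      then show False using cB by simp
    next
      case 2
      then show False using mixed C xy by blast
    next
      case 3
      then show False using mixed[of y x] C xy by (metis insert_commute)
    next
      case 4
      have "d \<le> card (B \<triangle> {x, y} \<triangle> {u, w})" using add_pair(2)[OF e C] u w uw by blast
      moreover have "int (card (B \<triangle> {x, y} \<triangle> {u, w})) \<le> int (card (B \<triangle> {x, y})) + 2"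
        using pair[OF finC uw] by auto
      moreover have "int (card (B \<triangle> {x, y})) = int (card B) - 2"
        using pair[OF B(2) xy(3)] 4 by simp
      ultimately show False using cB by simp
    qed
  next
    case False
    then have wX: "w \<notin> X" using both[of u w] u w uw by blast
    have XA: "X \<inter> A = {}" using both[of u] False u X(1) by blast
    define B where "B = A \<triangle> X"
    have finX: "finite X" using X card_ge_0_finite[of X] by simp
    have B: "B \<in> odd_sets I (E - {e}) \<tau>" "finite B" using X finA finX by (auto simp: B_def)
    have cB: "card B = d + 2"
      using card_sym_sum[OF finA finX] XA X A by (simp add: B_def Int_commute)
    obtain a b where ab: "X = {a, b}" "a \<noteq> b" using X card_2_iff by metis
    have four: "{a, b, u, w} \<subseteq> B \<inter> I e" "card {a, b, u, w} = 4"
      using ab u w wX False X XA uw by (auto simp: B_def)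
    obtain x y where xy: "x \<in> B" "y \<in> B" "x \<noteq> y" and C: "B \<triangle> {x, y} \<in> odd_sets I (E - {e}) \<tau>"
      using reduce_towards_empty[OF e B(1)] cB by auto
    have "card {x, y} = 2" using xy by simp
    then have "2 \<le> card ({a, b, u, w} - {x, y})"
      using diff_card_le_card_Diff[of "{x, y}" "{a, b, u, w}"] four by simp
    then obtain Y where Y: "Y \<subseteq> {a, b, u, w} - {x, y}" "card Y = 2"
      using obtain_subset_with_card_n by metis
    then obtain g h where gh: "Y = {g, h}" "g \<noteq> h" using card_2_iff by metis
    have "g \<in> I e" "h \<in> I e" using gh(1) Y(1) four(1) by blast+
    then have "d \<le> card (B \<triangle> {x, y} \<triangle> {g, h})" using add_pair(2)[OF e C] gh(2) by simp
    moreover have "int (card (B \<triangle> {x, y} \<triangle> {g, h})) = int (card (B \<triangle> {x, y})) - 2"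
    proof -
      have "g \<in> B \<triangle> {x, y}" "h \<in> B \<triangle> {x, y}" using gh Y four by auto
      then show ?thesis using pair[of "B \<triangle> {x, y}" g h] B gh by simp
    qed
    moreover have "int (card (B \<triangle> {x, y})) = int (card B) - 2"
      using pair[OF B(2) xy(3)] xy by simp
    ultimately show False using cB by simp
  qed
qed

text \<open>
  This is the step that makes the classes below closed under edges. The case distinction is that of
  \<open>optimal_meets_edge_once\<close>; in place of an odd set smaller than \<open>d\<close>, every case now ends in one of size \<open>d\<close>
  that contains \<open>z\<close>.
\<close>
lemma optimal_spreads_over_edge:
  assumes O: "optimal A" and e: "e \<in> E" and u: "u \<in> A" "u \<in> I e" and z: "z \<in> I e"
  shows "\<exists>A'. optimal A' \<and> z \<in> A'"
proof (rule ccontr)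
  assume no: "\<nexists>A'. optimal A' \<and> z \<in> A'"
  note pair = card_sym_sum_pair
  have finA: "finite A" and A: "A \<in> odd_sets I E \<tau>" "card A = d"
    using O optimal_finite by (auto simp: optimal_def)
  obtain X where X: "X \<subseteq> I e" "card X = 2" "A \<triangle> X \<in> odd_sets I (E - {e}) \<tau>"
    using iffD1[OF odd_sets_remove[OF finite_edges e] A(1)] by metis
  have zA: "z \<notin> A" using no O by blast
  then have uz: "u \<noteq> z" using u by blast
  have single: "A \<inter> I e = {u}" using optimal_meets_edge_once[OF O e] u by blast
  have avoid: False
    if "C \<in> odd_sets I (E - {e}) \<tau>" "g \<in> I e" "h \<in> I e" "g \<noteq> h"
      "card (C \<triangle> {g, h}) = d" "z \<in> C \<triangle> {g, h}" for C g h
    using add_pair(1)[OF e that(1-4)] that no by (auto simp: optimal_def)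
  have both: "u \<in> X \<longleftrightarrow> z \<in> X"
  proof (rule ccontr)
    assume "\<not> ?thesis"
    then have "A \<triangle> {u, z} \<in> odd_sets I E \<tau>"
      using switch_pair[OF e X(3,1,2), of u z] switch_pair[OF e X(3,1,2), of z u] u z
      by (auto simp: insert_commute)
    moreover have "card (A \<triangle> {u, z}) = d" using pair[OF finA uz] u zA A by simp
    moreover have "z \<in> A \<triangle> {u, z}" using zA by simp
    ultimately show False using no by (auto simp: optimal_def)
  qed
  show False
  proof (cases "u \<in> X")
    case True
    then have X_eq: "X = {u, z}"
      using both card_2_other[OF X(2), of u] uz by auto
    define B where "B = A \<triangle> X"
    have B: "B \<in> odd_sets I (E - {e}) \<tau>" "finite B" using X finA by (auto simp: B_def X_eq)
    have cB: "card B = d" using pair[OF finA uz] u zA A by (simp add: B_def X_eq)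
    have "B \<inter> I e = (A \<inter> I e) \<triangle> (X \<inter> I e)" by (auto simp: B_def)
    also have "\<dots> = {u} \<triangle> {u, z}" using single X_eq X(1) by (simp add: Int_absorb2)
    also have "\<dots> = {z}" using uz by auto
    finally have BI: "B \<inter> I e = {z}" .
    have "card (B \<triangle> I e) + 2 = card B + card (I e)"
      using card_sym_sum[OF B(2) finite_edge[OF e]] BI by simp
    then obtain x y where xy: "x \<in> B \<triangle> I e" "y \<in> B \<triangle> I e" "x \<noteq> y"
        and C: "B \<triangle> {x, y} \<in> odd_sets I (E - {e}) \<tau>"
      using reduce_towards_full[OF e B(1)] cB by auto
    have zxy: "z \<noteq> x" "z \<noteq> y" using xy BI by auto
    have third: "\<exists>c\<in>I e. c \<noteq> v \<and> c \<noteq> z" for v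
    proof -
      have "card {v, z} \<le> 2" by (simp add: card_insert_if)
      then have "\<not> I e \<subseteq> {v, z}"
        using edge_size[OF e] card_mono[of "{v, z}" "I e"] by fastforce
      then show ?thesis by blast
    qed
    have mixed: False if x: "x \<in> I e" "x \<notin> B" and y: "y \<in> B" "y \<notin> I e"
      and C: "B \<triangle> {x, y} \<in> odd_sets I (E - {e}) \<tau>" for x y
    proof -
      have xy: "x \<noteq> y" using x y by blast
      obtain c where c: "c \<in> I e" "c \<noteq> x" "c \<noteq> z" using third by blast
      have cB': "c \<notin> B" "c \<noteq> y" using c BI y by auto
      have "int (card (B \<triangle> {x, y} \<triangle> {x, c})) = int (card B)"
        using pair[of "B \<triangle> {x, y}" x c] pair[OF B(2) xy] B(2) c x y cB' by simp
      moreover have "z \<in> B \<triangle> {x, y} \<triangle> {x, c}" using c x y BI by auto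
      ultimately show False using avoid[OF C, of x c] c x cB by simp
    qed
    consider "x \<in> I e" "y \<in> I e" | "x \<in> I e" "x \<notin> B" "y \<in> B" "y \<notin> I e"
      | "x \<in> B" "x \<notin> I e" "y \<in> I e" "y \<notin> B" | "x \<in> B" "y \<in> B"
      using xy by auto
    then show False
    proof cases
      case 1
      then show False using avoid[OF C, of x y] cB xy BI by auto
    next
      case 2
      then show False using mixed C by blast
    next
      case 3
      then show False using mixed[of y x] C by (metis insert_commute)
    next
      case 4
      obtain g where g: "g \<in> I e" "g \<noteq> z" using u uz by blast
      obtain h where h: "h \<in> I e" "h \<noteq> g" "h \<noteq> z" using third by blast
      have gh: "g \<notin> B \<triangle> {x, y}" "h \<notin> B \<triangle> {x, y}" using g h 4 BI by auto
      have "int (card (B \<triangle> {x, y} \<triangle> {g, h})) = int (card B)"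
        using pair[of "B \<triangle> {x, y}" g h] pair[OF B(2) xy(3)] B(2) 4 gh h(2) by simp
      moreover have "z \<in> B \<triangle> {x, y} \<triangle> {g, h}" using zxy g h BI by auto
      ultimately show False using avoid[OF C, of g h] g h cB by simp
    qed
  next
    case False
    then have zX: "z \<notin> X" using both by blast
    have "A \<inter> X \<subseteq> {u}" using single X(1) by blast
    then have XA: "A \<inter> X = {}" using False by blast
    define B where "B = A \<triangle> X"
    have finX: "finite X" using X card_ge_0_finite[of X] by simp
    have B: "B \<in> odd_sets I (E - {e}) \<tau>" "finite B" using X finA finX by (auto simp: B_def)
    have cB: "card B = d + 2"
      using card_sym_sum[OF finA finX] XA X A by (simp add: B_def)
    obtain a b where ab: "X = {a, b}" "a \<noteq> b" using X card_2_iff by metis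
    have three: "{a, b, u} \<subseteq> B \<inter> I e" "a \<noteq> u" "b \<noteq> u"
      using ab u False X XA by (auto simp: B_def)
    obtain x y where xy: "x \<in> B" "y \<in> B" "x \<noteq> y" and C: "B \<triangle> {x, y} \<in> odd_sets I (E - {e}) \<tau>"
      using reduce_towards_empty[OF e B(1)] cB by auto
    have "\<exists>g\<in>{a, b, u}. g \<noteq> x \<and> g \<noteq> y" using three(2,3) ab(2) by auto
    then obtain g where g: "g \<in> {a, b, u}" "g \<noteq> x" "g \<noteq> y" by blast
    have zB: "z \<notin> B" using zA zX by (simp add: B_def)
    have gz: "g \<noteq> z" "z \<noteq> x" "z \<noteq> y" using g three zB xy by auto
    have gB: "g \<in> B" "g \<in> I e" using g three by auto
    have "int (card (B \<triangle> {x, y} \<triangle> {g, z})) = int (card B) - 2"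
      using pair[of "B \<triangle> {x, y}" g z] pair[OF B(2) xy(3)] B(2) xy gz zB g gB by simp
    moreover have "z \<in> B \<triangle> {x, y} \<triangle> {g, z}" using gz zB by auto
    ultimately show False using avoid[OF C, of g z] gz gB z cB by simp
  qed
qed

text \<open>
  The smallest odd sets satisfy the exchange property of matroid bases, obtained by moving \<open>A\<close>
  towards \<open>{w}\<close>. For matroids, being parallel is transitive, which is \<open>parallel_trans\<close> below and takes
  the place of Gallai's lemma.
\<close>
lemma optimal_replace:
  assumes A: "optimal A" and B: "optimal B" "w \<in> B"
  obtains "w \<in> A" | y where "y \<in> A" "optimal (A \<triangle> {w, y})" "w \<notin> A"
proof (cases "w \<in> A")
  case False
  note pair = card_sym_sum_pair
  have fin: "finite A" "finite B" using A B optimal_finite by auto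
  have cA: "A \<in> odd_sets I E \<tau>" "card A = d" and cB: "B \<in> odd_sets I E \<tau>" "card B = d"
    using A B by (auto simp: optimal_def)
  have "card (A \<triangle> {w}) = d + 1" "card (B \<triangle> {w}) + 1 = d"
    using card_sym_sum[OF fin(1), of "{w}"] card_sym_sum[OF fin(2), of "{w}"] False B cA cB
    by auto
  then obtain x y where xy: "x \<in> A \<triangle> {w}" "y \<in> A \<triangle> {w}" "x \<noteq> y"
      and C: "A \<triangle> {x, y} \<in> odd_sets I E \<tau>"
    using odd_sets_exchange[OF finite_edges finite_target, of "{w}" A I B] cA(1) cB(1)
    by (metis finite.emptyI finite.insertI less_add_one trans_less_add1)
  have "d \<le> card (A \<triangle> {x, y})" using C by (rule deficiency_le)
  then have "\<not> (x \<in> A \<and> y \<in> A)" using pair[OF fin(1) xy(3)] cA by auto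
  then consider "x = w" "y \<in> A" | "y = w" "x \<in> A" using xy by auto
  then obtain y' where y': "y' \<in> A" "A \<triangle> {w, y'} \<in> odd_sets I E \<tau>"
    using C by cases (auto simp: insert_commute)
  then have "card (A \<triangle> {w, y'}) = d"
    using pair[OF fin(1), of w y'] False cA by auto
  then show ?thesis using that(2) y' False by (auto simp: optimal_def)
qed

definition active :: "'v set" where
  "active = \<Union> {A. optimal A}"

definition parallel :: "'v \<Rightarrow> 'v \<Rightarrow> bool" where
  "parallel u w \<longleftrightarrow> u \<in> active \<and> w \<in> active \<and> (\<forall>A. optimal A \<longrightarrow> u \<in> A \<longrightarrow> w \<in> A \<longrightarrow> u = w)"

lemma parallel_refl: "optimal A \<Longrightarrow> u \<in> A \<Longrightarrow> parallel u u"
  by (auto simp: parallel_def active_def)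

lemma parallel_sym: "parallel u w \<Longrightarrow> parallel w u"
  by (auto simp: parallel_def)

lemma parallel_trans:
  assumes "parallel u v" "parallel v w"
  shows "parallel u w"
proof -
  have "u = w" if A: "optimal A" "u \<in> A" "w \<in> A" for A
  proof (rule ccontr)
    assume uw: "u \<noteq> w"
    obtain B where B: "optimal B" "v \<in> B" using assms by (auto simp: parallel_def active_def)
    from A(1) B show False
    proof (cases rule: optimal_replace)
      case 1
      then show False using assms A uw by (metis parallel_def)
    next
      case (2 y)
      then have "v \<in> A \<triangle> {v, y}" "u \<in> A \<triangle> {v, y} \<or> w \<in> A \<triangle> {v, y}" "v \<noteq> u" "v \<noteq> w"
        using A uw by auto
      then show False using assms 2 by (metis parallel_def)
    qed
  qed
  then show ?thesis using assms by (auto simp: parallel_def)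
qed

lemma parallel_edge:
  assumes "parallel u v" "e \<in> E" "v \<in> I e" "z \<in> I e"
  shows "parallel u z"
proof -
  have "v \<in> active" using assms by (simp add: parallel_def)
  then have "z \<in> active"
    using optimal_spreads_over_edge assms unfolding active_def by blast
  then have "parallel v z"
    using \<open>v \<in> active\<close> optimal_meets_edge_once assms by (auto simp: parallel_def)
  then show ?thesis using parallel_trans assms by blast
qed

text \<open>
  Every edge lies inside the class of \<open>u\<close> or outside it, so a selection does not change the parity
  on this class. A smallest odd set through \<open>u\<close> meets it only in \<open>u\<close>, so the target meets it in an
  odd number of vertices.
\<close>
lemma class_meets_target:
  assumes "optimal A" "u \<in> A"
  shows "\<exists>v\<in>\<tau>. parallel u v"
proof -
  let ?C = "{v. parallel u v}"
  have "A \<inter> ?C = {u}"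
    using assms parallel_refl by (auto simp: parallel_def)
  moreover have "odd (card (A \<inter> ?C)) \<longleftrightarrow> odd (card (\<tau> \<inter> ?C))"
    using assms parallel_edge finite_edges finite_target
    by (intro parity_odd_sets[of E _ _ I]) (auto simp: optimal_def)
  ultimately have "\<tau> \<inter> ?C \<noteq> {}" by fastforce
  then show ?thesis by blast
qed

text \<open>
  Distinct elements of \<open>A\<close> have disjoint classes, and each class uses up an element of the target.
\<close>
lemma card_optimal_le:
  assumes "optimal A"
  shows "card A \<le> card \<tau>"
proof -
  obtain f where f: "f u \<in> \<tau>" "parallel u (f u)" if "u \<in> A" for u
    using class_meets_target[OF assms] by metis
  have "inj_on f A"
  proof (rule inj_onI)
    fix u w assume uw: "u \<in> A" "w \<in> A" "f u = f w"
    then have "parallel u w" using f parallel_sym parallel_trans by metis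
    then show "u = w" using uw assms by (auto simp: parallel_def)
  qed
  then show ?thesis using f finite_target by (intro card_inj_on_le[of f]) auto
qed

end

section \<open>Removing edges until the instance is irreducible\<close>

text \<open>
  Edges are removed one at a time, each with maximal effect, so the effects add up. For an empty old
  target the new one lies in the edges of \<open>T\<close>, which bounds the number of classes by \<open>k * card T\<close>.
\<close>
lemma irreducible_reduction:
  fixes I :: "'e \<Rightarrow> 'v set"
  assumes "finite E" "finite \<tau>" "3 \<le> k" "\<forall>e\<in>E. card (I e) = k"
  shows "\<exists>S T \<tau>'. S \<subseteq> E \<and> T \<subseteq> E \<and> S \<inter> T = {} \<and> \<tau>' \<subseteq> \<tau> \<union> \<Union> (I ` T) \<and>
    irreducible_instance I (E - S - T) \<tau>' \<and>
    deficiency I E \<tau> + 2 * card S + (k - 2) * card T \<le> deficiency I (E - S - T) \<tau>'"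
  using assms
proof (induction E arbitrary: \<tau> rule: finite_psubset_induct)
  case (psubset E)
  show ?case
  proof (cases "irreducible_instance I E \<tau>")
    case True
    then show ?thesis by (intro exI[of _ "{}"] exI[of _ \<tau>]) simp
  next
    case False
    then obtain e where e: "e \<in> E" and bad:
      "deficiency I E \<tau> + 2 \<le> deficiency I (E - {e}) \<tau> \<or>
       deficiency I E \<tau> + k \<le> deficiency I (E - {e}) (\<tau> \<triangle> I e) + 2"
      using psubset unfolding irreducible_instance_def
      by (metis linorder_not_less)
    have finI: "finite (I e)" using psubset.prems e card_ge_0_finite[of "I e"] by simp
    have sub: "E - {e} \<subset> E" using e by blast
    have sizes: "\<forall>f\<in>E - {e}. card (I f) = k" using psubset.prems by blast
    from bad show ?thesis
    proof
      assume S_case: "deficiency I E \<tau> + 2 \<le> deficiency I (E - {e}) \<tau>"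
      obtain S T \<tau>' where *: "S \<subseteq> E - {e}" "T \<subseteq> E - {e}" "S \<inter> T = {}"
        "\<tau>' \<subseteq> \<tau> \<union> \<Union> (I ` T)" "irreducible_instance I (E - {e} - S - T) \<tau>'"
        "deficiency I (E - {e}) \<tau> + 2 * card S + (k - 2) * card T
           \<le> deficiency I (E - {e} - S - T) \<tau>'"
        using psubset.IH[OF sub psubset.prems(1,2) sizes] by blast
      have "E - {e} - S - T = E - insert e S - T" by blast
      moreover have "finite S" using *(1) psubset.hyps by (meson finite_Diff finite_subset)
      then have "card (insert e S) = card S + 1"
        using * by (subst card_insert_disjoint) auto
      moreover have "deficiency I E \<tau> + 2 * (card S + 1) + (k - 2) * card T
          \<le> deficiency I (E - {e} - S - T) \<tau>'"
        using *(6) S_case by simp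
      moreover have "insert e S \<subseteq> E" "T \<subseteq> E" "insert e S \<inter> T = {}" using *(1-3) e by blast+
      ultimately show ?thesis
        using *(4,5) by (intro exI[of _ "insert e S"] exI[of _ T] exI[of _ \<tau>']) simp
    next
      assume T_case: "deficiency I E \<tau> + k \<le> deficiency I (E - {e}) (\<tau> \<triangle> I e) + 2"
      obtain S T \<tau>' where *: "S \<subseteq> E - {e}" "T \<subseteq> E - {e}" "S \<inter> T = {}"
        "\<tau>' \<subseteq> \<tau> \<triangle> I e \<union> \<Union> (I ` T)" "irreducible_instance I (E - {e} - S - T) \<tau>'"
        "deficiency I (E - {e}) (\<tau> \<triangle> I e) + 2 * card S + (k - 2) * card T
           \<le> deficiency I (E - {e} - S - T) \<tau>'"
        using psubset.IH[OF sub finite_sym_sum[OF psubset.prems(1) finI] psubset.prems(2) sizes]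
        by blast
      have "E - {e} - S - T = E - S - insert e T" by blast
      moreover have "finite T" using *(2) psubset.hyps by (meson finite_Diff finite_subset)
      then have "card (insert e T) = card T + 1"
        using * by (subst card_insert_disjoint) auto
      moreover have "\<tau>' \<subseteq> \<tau> \<union> \<Union> (I ` insert e T)"
      proof -
        have "\<tau> \<triangle> I e \<subseteq> \<tau> \<union> I e" by auto
        then show ?thesis using *(4) by blast
      qed
      moreover have "deficiency I E \<tau> + 2 * card S + (k - 2) * (card T + 1)
          \<le> deficiency I (E - {e} - S - T) \<tau>'"
        using *(6) T_case psubset.prems(2) by simp
      moreover have "S \<subseteq> E" "insert e T \<subseteq> E" "S \<inter> insert e T = {}" using *(1-3) e by blast+
      ultimately show ?thesis
        using *(5) by (intro exI[of _ S] exI[of _ "insert e T"] exI[of _ \<tau>']) simp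
    qed
  qed
qed

section \<open>Counting\<close>

text \<open>
  An edge through \<open>u\<close> joins \<open>u\<close> to at most \<open>k - 1\<close> other elements of \<open>B\<close>.
\<close>
lemma degree_lower_bound:
  assumes "finite B" "finite N" "\<And>e. e \<in> N \<Longrightarrow> card (I e) = k" "1 \<le> k"
    and cover: "\<And>u w. u \<in> B \<Longrightarrow> w \<in> B \<Longrightarrow> u \<noteq> w \<Longrightarrow> \<exists>e\<in>N. u \<in> I e \<and> w \<in> I e"
    and u: "u \<in> B"
  shows "card B \<le> card {e \<in> N. u \<in> I e} * (k - 1) + 1"
proof -
  let ?N = "{e \<in> N. u \<in> I e}"
  have finI: "finite (I e)" if "e \<in> N" for e
    using assms that card_ge_0_finite[of "I e"] by simp
  have "B - {u} \<subseteq> (\<Union>e\<in>?N. I e - {u})" using cover[OF u] by blast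
  moreover have "finite (\<Union>e\<in>?N. I e - {u})" using finI assms(2) by auto
  ultimately have "card (B - {u}) \<le> card (\<Union>e\<in>?N. I e - {u})" by (rule card_mono[rotated])
  also have "\<dots> \<le> (\<Sum>e\<in>?N. card (I e - {u}))" using assms(2) by (intro card_UN_le) simp
  also have "\<dots> = (\<Sum>e\<in>?N. k - 1)"
    using finI assms(3) by (intro sum.cong) auto
  finally show ?thesis using assms(1) u by simp
qed

lemma degree_sum_upper_bound:
  assumes "finite B" "finite N" "\<And>e. e \<in> N \<Longrightarrow> card (I e) = k" "1 \<le> k"
  shows "(\<Sum>u\<in>B. card {e \<in> N. u \<in> I e}) \<le> k * card N"
proof -
  have "(\<Sum>u\<in>B. card {e \<in> N. u \<in> I e}) = (\<Sum>e\<in>N. card {u \<in> B. u \<in> I e})"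
    using assms(1,2) by (intro sum_multicount_gen) auto
  also have "\<dots> \<le> (\<Sum>e\<in>N. k)"
  proof (rule sum_mono)
    fix e assume "e \<in> N"
    then have "card (I e) = k" "finite (I e)" using assms card_ge_0_finite[of "I e"] by auto
    then show "card {u \<in> B. u \<in> I e} \<le> k" using card_mono[of "I e" "{u \<in> B. u \<in> I e}"] by auto
  qed
  finally show ?thesis by (simp add: mult.commute)
qed

text \<open>
  The intended values are \<open>q = card B\<close>, \<open>s = card S\<close>, \<open>t = card T\<close>. The first two bounds on \<open>q\<close> force
  \<open>s < t\<close>. For \<open>k \<ge> 4\<close> this contradicts \<open>2 * q \<le> k * (s + t)\<close>, the bound that comes from every element
  of \<open>B\<close> having degree at least 2. For \<open>k = 3\<close> that bound only gives \<open>t \<ge> s + 4\<close>, and the quadratic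
  bound finishes.
\<close>
lemma no_barrier_parameters:
  fixes q s t k :: nat
  assumes "3 \<le> k" "2 + 2 * s + (k - 2) * t \<le> q" "q \<le> k * t"
    and "2 * q \<le> k * (s + t)" "q * (q - 1) \<le> k * (s + t) * (k - 1)"
  shows False
proof -
  obtain j where j: "k = 3 + j" using assms(1) le_Suc_ex by blast
  have q: "2 + 2 * s + t + j * t \<le> q" using assms(2) by (simp add: j algebra_simps)
  have "q \<le> 3 * t + j * t" using assms(3) by (simp add: j algebra_simps)
  then have "s < t" using q by linarith
  have "2 * q \<le> 3 * s + 3 * t + j * s + j * t" using assms(4) by (simp add: j algebra_simps)
  then have *: "4 + s + j * t \<le> t + j * s" using q by linarith
  have "j = 0"
  proof (rule ccontr)
    assume "j \<noteq> 0"
    obtain r where r: "t = s + r" using \<open>s < t\<close> less_imp_add_positive by blast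
    have "j * t = j * s + j * r" by (simp add: r algebra_simps)
    moreover have "r \<le> j * r" using \<open>j \<noteq> 0\<close> by simp
    ultimately show False using * r by linarith
  qed
  then have t: "4 + s \<le> t" and q: "2 + 2 * s + t \<le> q" and le: "q * (q - 1) \<le> 6 * (s + t)"
    using * q assms(5) by (auto simp: j)
  define x where "x = 2 * s + t"
  have "(x + 2) * (x + 1) \<le> q * (q - 1)" using q by (intro mult_le_mono) (auto simp: x_def)
  moreover have "6 * (s + t) \<le> 6 * x" by (simp add: x_def)
  moreover have "4 * x \<le> x * x" using t by (intro mult_le_mono1) (simp add: x_def)
  moreover have "(x + 2) * (x + 1) = x * x + 3 * x + 2" by (simp add: algebra_simps)
  ultimately show False using le t by (simp add: x_def)
qed

section \<open>Even selections\<close>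

lemma odd_sets_subset: "A \<in> odd_sets I E \<tau> \<Longrightarrow> A \<subseteq> \<tau> \<union> \<Union> (I ` E)"
proof
  fix v assume A: "A \<in> odd_sets I E \<tau>" "v \<in> A"
  then obtain p where p: "selection I E p" "A = \<tau> \<triangle> odd_verts p E" by (auto simp: odd_sets_def)
  show "v \<in> \<tau> \<union> \<Union> (I ` E)"
  proof (cases "v \<in> \<tau>")
    case False
    then have "odd (card {e \<in> E. v \<in> p e})" using A p by (simp add: odd_verts_def)
    then have "{e \<in> E. v \<in> p e} \<noteq> {}" by (metis card.empty even_zero)
    then show ?thesis using p by (auto simp: selection_def)
  qed simp
qed

text \<open>
  The reduction is applied with empty target. The odd sets are then even in size, so a positive
  deficiency is at least 2, which is the 2 in the lower bound on \<open>card B\<close>.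
\<close>
lemma even_selection:
  fixes I :: "'e \<Rightarrow> 'v set"
  assumes E: "finite E" "2 \<le> card E" and k: "3 \<le> k" "\<And>e. e \<in> E \<Longrightarrow> card (I e) = k"
    and cover: "\<And>u w. u \<in> \<Union> (I ` E) \<Longrightarrow> w \<in> \<Union> (I ` E) \<Longrightarrow> u \<noteq> w \<Longrightarrow>
      \<exists>e\<in>E. u \<in> I e \<and> w \<in> I e"
  shows "{} \<in> odd_sets I E {}"
proof -
  have finI: "finite (I e)" if "e \<in> E" for e
    using k that card_ge_0_finite[of "I e"] by simp
  have sizes: "\<forall>e\<in>E. card (I e) = k" using k by blast
  have two: "2 \<le> card (I e)" if "e \<in> E" for e using k that by simp
  obtain A0 where A0: "A0 \<in> odd_sets I E {}" "card A0 = deficiency I E {}"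
    using deficiency_attained[of E I "{}"] E(1) two by metis
  have "finite A0" using finite_odd_sets A0 E by blast
  have "even (card A0)" using parity_odd_sets[OF E(1) _ A0(1), of UNIV] by simp
  show ?thesis
  proof (cases "card A0 = 0")
    case True
    then show ?thesis using A0 \<open>finite A0\<close> by simp
  next
    case False
    then have d2: "2 \<le> deficiency I E {}" using \<open>even (card A0)\<close> A0 by (metis dvd_imp_le gr0I)
    obtain S T \<tau> where ST: "S \<subseteq> E" "T \<subseteq> E" "S \<inter> T = {}" "\<tau> \<subseteq> {} \<union> \<Union> (I ` T)"
        and irr: "irreducible_instance I (E - S - T) \<tau>"
        and tight: "deficiency I E {} + 2 * card S + (k - 2) * card T
          \<le> deficiency I (E - S - T) \<tau>"
      using irreducible_reduction[OF E(1) finite.emptyI k(1) sizes]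
      by (elim exE conjE) (rule that)
    interpret irreducible_instance I "E - S - T" \<tau> by (fact irr)
    obtain B where "B \<in> odd_sets I (E - S - T) \<tau>" "card B = d"
      using deficiency_attained[of "E - S - T" I \<tau>] E(1) two by (metis DiffD1 finite_Diff)
    then have B: "optimal B" by (simp add: optimal_def)
    have finB: "finite B" using B by (rule optimal_finite)
    have B_lower: "2 + 2 * card S + (k - 2) * card T \<le> card B"
      using tight d2 B by (simp add: optimal_def)
    have finST: "finite S" "finite T" using ST E finite_subset by auto
    have "card \<tau> \<le> card (\<Union> (I ` T))"
      using ST finST finI by (intro card_mono) auto
    also have "\<dots> \<le> (\<Sum>e\<in>T. card (I e))" by (rule card_UN_le[OF finST(2)])
    also have "\<dots> = (\<Sum>e\<in>T. k)" using ST k by (intro sum.cong) auto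
    finally have B_upper: "card B \<le> k * card T"
      using card_optimal_le[OF B] by (simp add: mult.commute)
    have B_sub: "B \<subseteq> \<Union> (I ` E)"
      using odd_sets_subset[of B I "E - S - T" \<tau>] B ST by (fastforce simp: optimal_def)
    have B_cover: "\<exists>e\<in>S \<union> T. u \<in> I e \<and> w \<in> I e" if uw: "u \<in> B" "w \<in> B" "u \<noteq> w" for u w
    proof -
      have "u \<in> \<Union> (I ` E)" "w \<in> \<Union> (I ` E)" using uw(1,2) B_sub by (auto dest: subsetD)
      from cover[OF this uw(3)] obtain e where e: "e \<in> E" "u \<in> I e" "w \<in> I e" by blast
      then have "e \<notin> E - S - T" using optimal_meets_edge_once[OF B] uw by metis
      then show ?thesis using e by blast
    qed
    have lt: "card S < card T"
    proof -
      obtain j where "k = 2 + j" using k(1) le_Suc_ex[of 2 k] by auto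
      then have "k * card T = (k - 2) * card T + 2 * card T" by (simp add: algebra_simps)
      then show ?thesis using B_lower B_upper by linarith
    qed
    show ?thesis
    proof (cases "card T = 1")
      case True
      then obtain e where T: "T = {e}" using card_1_singletonE by blast
      have S: "S = {}" using lt True finST by simp
      have "2 \<le> card B" using B_lower by simp
      then obtain u w where uw: "u \<in> B" "w \<in> B" "u \<noteq> w"
        by (metis card_le_Suc0_iff_eq finB not_less_eq_eq numeral_2_eq_2)
      have ue: "u \<in> I e" "w \<in> I e" using B_cover[OF uw] S T by auto
      have "\<not> E \<subseteq> {e}" using E card_mono[of "{e}" E] by auto
      then obtain f where f: "f \<in> E" "f \<noteq> e" by blast
      have eE: "e \<in> E" using T ST by simp
      show ?thesis
      proof (cases "I f = I e")
        case True
        then have "u = w" using optimal_meets_edge_once[OF B, of f u w] uw ue f S T by auto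
        then show ?thesis using uw by simp
      next
        case False
        then have "\<not> I f \<subseteq> I e"
          using card_subset_eq[OF finI[OF eE], of "I f"] k(2) f eE by auto
        then obtain z where z: "z \<in> I f" "z \<notin> I e" by blast
        \<comment> \<open>An edge through \<open>v\<close> and \<open>z\<close> is not \<open>e\<close>, so it was not removed and spreads the class of \<open>v\<close> to \<open>z\<close>.\<close>
        have par: "parallel v z" if v: "v \<in> B" "v \<in> I e" for v
        proof -
          have "v \<noteq> z" using v z by blast
          then obtain g where g: "g \<in> E" "v \<in> I g" "z \<in> I g"
            using cover[of v z] v eE f z by blast
          then have "g \<in> E - S - T" using z S T by blast
          then show ?thesis using parallel_edge[OF parallel_refl[OF B v(1)]] g by blast
        qed
        have "parallel u w" using par[OF uw(1) ue(1)] par[OF uw(2) ue(2)]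
          by (metis parallel_sym parallel_trans)
        then have False using uw B by (auto simp: parallel_def)
        then show ?thesis ..
      qed
    next
      case False
      then have T2: "2 \<le> card T" using lt by linarith
      let ?N = "S \<union> T"
      have N: "finite ?N" "card ?N = card S + card T"
        using finST ST card_Un_disjoint by auto
      have kN: "card (I e) = k" if "e \<in> ?N" for e using that ST k by blast
      define r where "r u = card {e \<in> ?N. u \<in> I e}" for u
      have r_lower: "card B \<le> r u * (k - 1) + 1" if "u \<in> B" for u
        unfolding r_def using degree_lower_bound[OF finB N(1) kN _ B_cover that] k(1) by simp
      have r_sum: "(\<Sum>u\<in>B. r u) \<le> k * (card S + card T)"
        unfolding r_def N(2)[symmetric]
        using degree_sum_upper_bound[OF finB N(1) kN] k(1) by simp
      have "2 \<le> r u" if u: "u \<in> B" for u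
      proof (rule ccontr)
        assume "\<not> 2 \<le> r u"
        then have "r u * (k - 1) \<le> 1 * (k - 1)" by (intro mult_le_mono1) simp
        then have "card B \<le> k" using r_lower[OF u] k(1) by linarith
        moreover have "(k - 2) * 2 \<le> (k - 2) * card T" using T2 by (intro mult_le_mono2)
        ultimately show False using B_lower k(1) by linarith
      qed
      then have "(\<Sum>u\<in>B. 2) \<le> (\<Sum>u\<in>B. r u)" by (rule sum_mono)
      then have "2 * card B \<le> k * (card S + card T)" using r_sum by simp
      moreover have "card B * (card B - 1) \<le> k * (card S + card T) * (k - 1)"
      proof -
        have "(\<Sum>u\<in>B. card B - 1) \<le> (\<Sum>u\<in>B. r u * (k - 1))"
          using r_lower by (intro sum_mono) fastforce
        also have "\<dots> = (\<Sum>u\<in>B. r u) * (k - 1)" by (simp add: sum_distrib_right)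
        also have "\<dots> \<le> k * (card S + card T) * (k - 1)" using r_sum by (rule mult_le_mono1)
        finally show ?thesis by simp
      qed
      ultimately have False
        using no_barrier_parameters[OF k(1) B_lower B_upper] by blast
      then show ?thesis ..
    qed
  qed
qed

section \<open>Closed trails of an even multigraph\<close>

text \<open>
  A walk in the multigraph whose edge \<open>e\<close> has the two ends \<open>p e\<close>, as its lists of vertices and edges.
\<close>
fun joins :: "('e \<Rightarrow> 'v set) \<Rightarrow> 'v list \<Rightarrow> 'e list \<Rightarrow> bool" where
  "joins p [v] [] = True"
| "joins p (u # v # vs) (e # es) = (u \<noteq> v \<and> p e = {u, v} \<and> joins p (v # vs) es)"
| "joins p _ _ = False"

lemma joins_nonempty: "joins p vs es \<Longrightarrow> vs \<noteq> []"
  by auto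

lemma joins_append:
  "joins p us es \<Longrightarrow> joins p vs fs \<Longrightarrow> last us = hd vs \<Longrightarrow> joins p (us @ tl vs) (es @ fs)"
proof (induction p us es rule: joins.induct)
  case (1 p v)
  then show ?case by (cases vs) auto
qed auto

lemma joins_split:
  assumes "joins p vs es" "v \<in> set vs"
  shows "\<exists>us1 es1 us2 es2. joins p us1 es1 \<and> joins p us2 es2 \<and> hd us1 = hd vs \<and> last us1 = v \<and>
    hd us2 = v \<and> last us2 = last vs \<and> es = es1 @ es2"
  using assms
proof (induction p vs es rule: joins.induct)
  case (1 p u)
  then show ?case by (intro exI[of _ "[u]"] exI[of _ "[]"]) auto
next
  case (2 p u w vs e es)
  show ?case
  proof (cases "v = u")
    case True
    then show ?thesis
      using 2 by (intro exI[of _ "[u]"] exI[of _ "[]"] exI[of _ "u # w # vs"] exI[of _ "e # es"]) auto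
  next
    case False
    then obtain us1 es1 us2 es2 where *: "joins p us1 es1" "joins p us2 es2" "hd us1 = w"
      "last us1 = v" "hd us2 = v" "last us2 = last (w # vs)" "es = es1 @ es2"
      using 2 by auto
    obtain us where "us1 = w # us" using * by (cases us1) auto
    then show ?thesis
      using * 2 by (intro exI[of _ "u # us1"] exI[of _ "e # es1"] exI[of _ us2] exI[of _ es2]) auto
  qed
qed auto

lemma odd_verts_joins:
  "joins p vs es \<Longrightarrow> distinct es \<Longrightarrow> odd_verts p (set es) = {hd vs} \<triangle> {last vs}"
proof (induction p vs es rule: joins.induct)
  case (2 p u v vs e es)
  then have "odd_verts p (set (e # es)) = odd_verts p (set es) \<triangle> p e"
    using odd_verts_insert[of "set es" e p] by simp
  also have "\<dots> = {v} \<triangle> {last (v # vs)} \<triangle> {u, v}" using 2 by simp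
  also have "\<dots> = {u} \<triangle> {last (v # vs)}" using 2 by auto
  finally show ?case by simp
qed auto

lemma verts_joins: "joins p vs es \<Longrightarrow> es \<noteq> [] \<Longrightarrow> set vs = \<Union> (p ` set es)"
proof (induction p vs es rule: joins.induct)
  case (2 p u v vs e es)
  show ?case
  proof (cases es)
    case Nil
    then have "vs = []" using "2.prems" by (cases vs) auto
    then show ?thesis using "2.prems" Nil by auto
  next
    case (Cons f fs)
    then have "set (v # vs) = \<Union> (p ` set es)" using 2 by auto
    then show ?thesis using "2.prems" by auto
  qed
qed auto

lemma is_walk_joins:
  assumes "joins p vs es" "es \<noteq> []"
    and "\<And>e. e \<in> set es \<Longrightarrow> e \<in> edges H \<and> p e \<subseteq> inc H e \<and> inc H e \<subseteq> verts H"
  shows "is_walk H (vs, es)"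
proof -
  have "length vs = Suc (length es) \<and>
      (\<forall>i<length es. vs ! i \<noteq> vs ! Suc i \<and> vs ! i \<in> p (es ! i) \<and> vs ! Suc i \<in> p (es ! i))"
    using assms(1)
  proof (induction p vs es rule: joins.induct)
    case (2 p u v vs e es)
    then show ?case by (auto simp: All_less_Suc2)
  qed auto
  moreover have "set vs \<subseteq> verts H" using verts_joins[OF assms(1,2)] assms(3) by blast
  ultimately show ?thesis using assms(3) unfolding is_walk_def
    by (auto simp: subset_iff)
qed

lemma odd_verts_Un:
  assumes "finite D" "finite E" "D \<inter> E = {}"
  shows "odd_verts p (D \<union> E) = odd_verts p D \<triangle> odd_verts p E"
proof (rule set_eqI)
  fix v
  have "{e \<in> D \<union> E. v \<in> p e} = {e \<in> D. v \<in> p e} \<union> {e \<in> E. v \<in> p e}" by blast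
  moreover have "card ({e \<in> D. v \<in> p e} \<union> {e \<in> E. v \<in> p e}) =
      card {e \<in> D. v \<in> p e} + card {e \<in> E. v \<in> p e}"
    using assms by (intro card_Un_disjoint) auto
  ultimately show "v \<in> odd_verts p (D \<union> E) \<longleftrightarrow> v \<in> odd_verts p D \<triangle> odd_verts p E"
    by (simp add: odd_verts_def)
qed

text \<open>
  Take a longest trail. Its last vertex has no unused edge; if the trail were not closed, this
  vertex would have odd degree in the trail and hence in the whole multigraph. Being closed, the trail
  can be rotated to end at any of its vertices, so none of them has an unused edge.
\<close>
lemma saturated_closed_trail:
  assumes fin: "finite E" and size: "\<And>e. e \<in> E \<Longrightarrow> card (p e) = 2"
    and even: "odd_verts p E = {}" and "E \<noteq> {}"
  obtains vs es where "joins p vs es" "distinct es" "es \<noteq> []" "set es \<subseteq> E" "hd vs = last vs"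
    "\<And>f. f \<in> E - set es \<Longrightarrow> p f \<inter> set vs = {}"
proof -
  define trail where "trail W \<longleftrightarrow> joins p (fst W) (snd W) \<and> distinct (snd W) \<and> set (snd W) \<subseteq> E"
    for W
  have bound: "length (snd W) < Suc (card E)" if "trail W" for W
    using that fin card_mono[of E "set (snd W)"] by (auto simp: trail_def distinct_card)
  obtain e where e: "e \<in> E" using \<open>E \<noteq> {}\<close> by blast
  then obtain a b where "p e = {a, b}" "a \<noteq> b" using size card_2_iff by metis
  then have start: "trail ([a, b], [e])" using e by (simp add: trail_def)
  have "\<exists>W. trail W \<and> (\<forall>W'. trail W' \<longrightarrow> length (snd W') \<le> length (snd W))"
    using ex_has_greatest_nat[of trail, OF start, of "\<lambda>W. length (snd W)"] bound by blast
  then obtain vs es where W: "trail (vs, es)"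
    and longest: "\<And>us fs. trail (us, fs) \<Longrightarrow> length fs \<le> length es" by auto
  have es: "joins p vs es" "distinct es" "set es \<subseteq> E" using W by (auto simp: trail_def)
  have "es \<noteq> []" using longest[OF start] by auto
  have stuck: "last us \<notin> p f" if f: "f \<in> E - set es"
    and us: "joins p us fs" "set fs = set es" "distinct fs" for us fs f
  proof
    assume "last us \<in> p f"
    then obtain x where x: "p f = {last us, x}" "last us \<noteq> x"
      using card_2_other[of "p f" "last us"] size[of f] f by auto
    have "joins p (us @ tl [last us, x]) (fs @ [f])"
      using us x by (intro joins_append) auto
    then have "trail (us @ [x], fs @ [f])" using us f es by (auto simp: trail_def)
    then have "length (fs @ [f]) \<le> length es" by (rule longest)
    moreover have "length fs = length es" using us es by (metis distinct_card)
    ultimately show False by simp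
  qed
  have closed: "hd vs = last vs"
  proof (rule ccontr)
    assume "hd vs \<noteq> last vs"
    then have "last vs \<in> odd_verts p (set es)" using odd_verts_joins[OF es(1,2)] by auto
    moreover have "odd_verts p (set es \<union> (E - set es)) = odd_verts p (set es) \<triangle> odd_verts p (E - set es)"
      using fin by (intro odd_verts_Un) auto
    moreover have "set es \<union> (E - set es) = E" using es by blast
    ultimately have "last vs \<in> odd_verts p (E - set es)" using even by auto
    then have "odd (card {f \<in> E - set es. last vs \<in> p f})" by (simp add: odd_verts_def)
    then have "{f \<in> E - set es. last vs \<in> p f} \<noteq> {}" by (metis card.empty even_zero)
    then obtain f where "f \<in> E - set es" "last vs \<in> p f" by blast
    then show False using stuck[OF _ es(1) refl es(2)] by blast
  qed
  have "p f \<inter> set vs = {}" if f: "f \<in> E - set es" for f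
  proof (rule ccontr)
    assume "p f \<inter> set vs \<noteq> {}"
    then obtain v where v: "v \<in> p f" "v \<in> set vs" by blast
    obtain us1 es1 us2 es2 where *: "joins p us1 es1" "joins p us2 es2" "hd us1 = hd vs"
      "last us1 = v" "hd us2 = v" "last us2 = last vs" "es = es1 @ es2"
      using joins_split[OF es(1) v(2)] by blast
    have "joins p (us2 @ tl us1) (es2 @ es1)" using * closed by (intro joins_append) auto
    moreover have "last (us2 @ tl us1) = v"
      using * closed joins_nonempty[OF *(1)] by (cases us1) auto
    ultimately show False using stuck[OF f, of "us2 @ tl us1" "es2 @ es1"] * es v by auto
  qed
  then show ?thesis using that es \<open>es \<noteq> []\<close> closed by blast
qed

definition trail_decomposition :: "('e \<Rightarrow> 'v set) \<Rightarrow> 'e set \<Rightarrow> ('v list \<times> 'e list) set \<Rightarrow> bool" where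
  "trail_decomposition p E F \<longleftrightarrow>
    (\<forall>W\<in>F. joins p (fst W) (snd W) \<and> distinct (snd W) \<and> snd W \<noteq> [] \<and>
      hd (fst W) = last (fst W)) \<and>
    (\<forall>W\<in>F. \<forall>W'\<in>F. W \<noteq> W' \<longrightarrow> set (snd W) \<inter> set (snd W') = {} \<and> set (fst W) \<inter> set (fst W') = {}) \<and>
    (\<Union>W\<in>F. set (snd W)) = E"

text \<open>
  Removing a saturated closed trail keeps all degrees even, and the remaining edges do not touch
  its vertices.
\<close>
lemma even_multigraph_trails:
  assumes "finite E" "\<forall>e\<in>E. card (p e) = 2" "odd_verts p E = {}"
  shows "\<exists>F. trail_decomposition p E F"
  using assms
proof (induction E rule: finite_psubset_induct)
  case (psubset E)
  show ?case
  proof (cases "E = {}")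
    case True
    then show ?thesis by (intro exI[of _ "{}"]) (simp add: trail_decomposition_def)
  next
    case False
    obtain vs es where W: "joins p vs es" "distinct es" "es \<noteq> []" "set es \<subseteq> E" "hd vs = last vs"
      and sat: "\<And>f. f \<in> E - set es \<Longrightarrow> p f \<inter> set vs = {}"
      using saturated_closed_trail[of E p] psubset.hyps psubset.prems False by metis
    have "odd_verts p (set es \<union> (E - set es)) = odd_verts p (set es) \<triangle> odd_verts p (E - set es)"
      using psubset.hyps by (intro odd_verts_Un) auto
    moreover have "set es \<union> (E - set es) = E" using W by blast
    ultimately have "odd_verts p (E - set es) = {}"
      using psubset.prems odd_verts_joins[OF W(1,2)] W(5) by simp
    moreover have "E - set es \<subset> E" using W by (cases es) auto
    ultimately obtain F where "trail_decomposition p (E - set es) F"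
      using psubset.IH[of "E - set es"] psubset.prems(1) by blast
    then have F:
      "\<And>W. W \<in> F \<Longrightarrow> joins p (fst W) (snd W) \<and> distinct (snd W) \<and> snd W \<noteq> [] \<and> hd (fst W) = last (fst W)"
      "\<And>W W'. W \<in> F \<Longrightarrow> W' \<in> F \<Longrightarrow> W \<noteq> W' \<Longrightarrow>
        set (snd W) \<inter> set (snd W') = {} \<and> set (fst W) \<inter> set (fst W') = {}"
      "(\<Union>W\<in>F. set (snd W)) = E - set es"
      unfolding trail_decomposition_def by blast+
    have new: "set (snd W') \<inter> set es = {} \<and> set (fst W') \<inter> set vs = {}" if "W' \<in> F" for W'
    proof -
      have "set (snd W') \<subseteq> E - set es" using F(3) that by blast
      moreover have "set (fst W') = \<Union> (p ` set (snd W'))" using verts_joins F(1)[OF that] by blast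
      ultimately show ?thesis using sat by blast
    qed
    have "trail_decomposition p E (insert (vs, es) F)"
      unfolding trail_decomposition_def
    proof (intro conjI)
      show "(\<Union>W\<in>insert (vs, es) F. set (snd W)) = E" using F(3) W(4) by auto
      show "\<forall>W\<in>insert (vs, es) F. joins p (fst W) (snd W) \<and> distinct (snd W) \<and> snd W \<noteq> [] \<and>
        hd (fst W) = last (fst W)" using F(1) W by simp
      show "\<forall>W\<in>insert (vs, es) F. \<forall>W'\<in>insert (vs, es) F. W \<noteq> W' \<longrightarrow>
        set (snd W) \<inter> set (snd W') = {} \<and> set (fst W) \<inter> set (fst W') = {}"
      proof (intro ballI impI)
        fix W1 W2 assume "W1 \<in> insert (vs, es) F" "W2 \<in> insert (vs, es) F" "W1 \<noteq> W2"
        then consider "W1 \<in> F" "W2 \<in> F" | "W1 = (vs, es)" "W2 \<in> F" | "W1 \<in> F" "W2 = (vs, es)"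
          by blast
        then show "set (snd W1) \<inter> set (snd W2) = {} \<and> set (fst W1) \<inter> set (fst W2) = {}"
          using F(2)[of W1 W2] new[of W1] new[of W2] \<open>W1 \<noteq> W2\<close>
          by cases (auto simp: Int_commute)
      qed
    qed
    then show ?thesis ..
  qed
qed

lemma quasi_eulerian_of_even_selection:
  assumes H: "hypergraph H" and "{} \<in> odd_sets (inc H) (edges H) {}"
  shows "quasi_eulerian H"
proof -
  obtain p where p: "selection (inc H) (edges H) p" "odd_verts p (edges H) = {}"
    using assms(2) by (auto simp: odd_sets_def)
  have "finite (edges H)" using H by (simp add: hypergraph_def)
  then obtain F where "trail_decomposition p (edges H) F"
    using even_multigraph_trails[of "edges H" p] p unfolding selection_def by blast
  then have F:
      "\<And>W. W \<in> F \<Longrightarrow> joins p (fst W) (snd W) \<and> distinct (snd W) \<and> snd W \<noteq> [] \<and> hd (fst W) = last (fst W)"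
      "\<And>W W'. W \<in> F \<Longrightarrow> W' \<in> F \<Longrightarrow> W \<noteq> W' \<Longrightarrow>
        set (snd W) \<inter> set (snd W') = {} \<and> set (fst W) \<inter> set (fst W') = {}"
      "(\<Union>W\<in>F. set (snd W)) = edges H"
    unfolding trail_decomposition_def by blast+
  have "is_walk H W" if "W \<in> F" for W
  proof -
    have "e \<in> edges H" if "e \<in> set (snd W)" for e using F(3) \<open>W \<in> F\<close> that by blast
    then have "is_walk H (fst W, snd W)"
      using F(1)[OF that] p(1) H
      by (intro is_walk_joins[of p]) (simp_all add: selection_def hypergraph_def)
    then show ?thesis by simp
  qed
  then have "euler_family H F"
    using F by (auto simp: euler_family_def strict_trail_def closed_walk_def trivial_walk_def
        walk_edges_def anchors_def)
  then show ?thesis by (auto simp: quasi_eulerian_def)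
qed

lemma two_edges_of_quasi_eulerian:
  assumes "finite (edges H)" "edges H \<noteq> {}" "quasi_eulerian H"
  shows "2 \<le> card (edges H)"
proof -
  obtain F where F: "euler_family H F" using assms by (auto simp: quasi_eulerian_def)
  then obtain W where "W \<in> F" using assms(2) by (fastforce simp: euler_family_def)
  then obtain vs es where W: "is_walk H (vs, es)" "distinct es" "es \<noteq> []" "hd vs = last vs"
    using F by (cases W) (auto simp: euler_family_def strict_trail_def closed_walk_def trivial_walk_def)
  have "2 \<le> length es"
  proof (rule ccontr)
    assume "\<not> 2 \<le> length es"
    moreover have "length es \<noteq> 0" using W(3) by simp
    ultimately have "length es = 1" by linarith
    then obtain e a b where "es = [e]" "vs = [a, b]"
      using W(1) by (auto simp: is_walk_def length_Suc_conv)
    then show False using W by (auto simp: is_walk_def)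
  qed
  moreover have "length es = card (set es)" using W by (simp add: distinct_card)
  moreover have "card (set es) \<le> card (edges H)"
    using W assms by (intro card_mono) (auto simp: is_walk_def)
  ultimately show ?thesis by simp
qed

theorem theorem6p1p1:
  fixes H :: "('v, 'e) pre_hypergraph" and l k :: nat
  assumes "2 \<le> l" and "l < k"
    and "covering_hypergraph l k H"
  shows "quasi_eulerian H \<longleftrightarrow> card (edges H) \<ge> 2"
proof
  assume "quasi_eulerian H"
  then show "card (edges H) \<ge> 2"
    using assms(3) two_edges_of_quasi_eulerian
    by (auto simp: covering_hypergraph_def hypergraph_def)
next
  assume two: "card (edges H) \<ge> 2"
  have H: "hypergraph H" and k: "\<And>e. e \<in> edges H \<Longrightarrow> card (inc H e) = k"
    and cov: "\<And>S. S \<subseteq> verts H \<Longrightarrow> card S = l \<Longrightarrow> \<exists>e\<in>edges H. S \<subseteq> inc H e"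
    and "edges H \<noteq> {}"
    using assms(3) by (auto simp: covering_hypergraph_def)
  have fin: "finite (verts H)" "finite (edges H)" and sub: "\<And>e. e \<in> edges H \<Longrightarrow> inc H e \<subseteq> verts H"
    using H by (auto simp: hypergraph_def)
  have "k \<le> card (verts H)"
    using \<open>edges H \<noteq> {}\<close> k sub fin card_mono by (metis ex_in_conv)
  have cover: "\<exists>e\<in>edges H. u \<in> inc H e \<and> w \<in> inc H e"
    if "u \<in> verts H" "w \<in> verts H" "u \<noteq> w" for u w
  proof -
    have "card {u, w} \<le> l" using that assms(1) by simp
    moreover have "l \<le> card (verts H)" using \<open>k \<le> card (verts H)\<close> assms(2) by simp
    moreover have "{u, w} \<subseteq> verts H" using that by blast
    ultimately have "\<exists>S. {u, w} \<subseteq> S \<and> S \<subseteq> verts H \<and> card S = l"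
      by (rule exists_subset_between[OF _ _ _ fin(1)])
    then obtain S where S: "{u, w} \<subseteq> S" "S \<subseteq> verts H" "card S = l" by blast
    then show ?thesis using cov[OF S(2,3)] by blast
  qed
  have "{} \<in> odd_sets (inc H) (edges H) {}"
  proof (rule even_selection[OF fin(2) two _ k])
    show "3 \<le> k" using assms(1,2) by simp
    show "\<exists>e\<in>edges H. u \<in> inc H e \<and> w \<in> inc H e"
      if "u \<in> \<Union> (inc H ` edges H)" "w \<in> \<Union> (inc H ` edges H)" "u \<noteq> w" for u w
    proof (rule cover)
      show "u \<in> verts H" "w \<in> verts H" using that(1,2) sub by blast+
    qed (fact that(3))
  qed
  then show "quasi_eulerian H" using quasi_eulerian_of_even_selection H by blast
qed

end
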